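(* Let $\mathbb{N}$ be a real antisymmetric $n\times n$ matrix of corank $1$, $n=2k+1$, and write it, in a suitable orthonormal basis of $\mathbb{R}^n$, as $\mathbb{N}=\begin{bmatrix}\bar{\mathbb{N}}&0\\0&0\end{bmatrix}$ with $\bar{\mathbb{N}}$ an invertible antisymmetric $2k\times 2k$ matrix. Then the Bloch--Iserles system $\dot X(t)=[X(t)^2,\mathbb{N}]$ on the space of real symmetric $n\times n$ matrices describes geodesic motion on the Jacobi group $\operatorname{Jac}(\mathbb{R}^{2k},-\bar{\mathbb{N}}^{-1})$ relative to the left invariant Riemannian metric given at the identity by the Lagrangian (kinetic energy) $$\ell(\mathcal{S}_0,\mathcal{S}_1,\mathcal{S}_2)=\tfrac12\operatorname{Tr}\big(\mathcal{S}_2^T(-\bar{\mathbb{N}}^{-2})\mathcal{S}_2\big)+\mathcal{S}_1^T(-\bar{\mathbb{N}}^{-2})\mathcal{S}_1+2\mathcal{S}_0^2 .$$ That is, a curve $\gamma(t)$ in $\operatorname{Jac}(\mathbb{R}^{2k},-\bar{\mathbb{N}}^{-1})$ is a geodesic of this metric if and only if, writing $\gamma^{-1}\dot\gamma=(\mathcal{S}_2,\mathcal{S}_1,\mathcal{S}_0)\in\mathfrak{jac}(\mathbb{R}^{2k},-\bar{\mathbb{N}}^{-1})$, the curve of symmetric matrices $$X(t)=\begin{bmatrix}S_2&S_1^T\\S_1&2S_0\end{bmatrix},\qquad S_2=\bar{\mathbb{N}}^{-1}\mathcal{S}_2,\quad S_1^T=\bar{\mathbb{N}}^{-1}\mathcal{S}_1,\quad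 S_0=\mathcal{S}_0,$$ satisfies $\dot X=[X^2,\mathbb{N}]$.
   Context: $[\cdot,\cdot]$ is the matrix commutator. For a symplectic vector space $(V,\Omega)$, the Jacobi group is $\operatorname{Jac}(V,\Omega)=\operatorname{Sp}(V,\Omega)\times V\times\mathbb{R}$ with multiplication $(g,u,a)(h,v,b)=\big(gh,\,u+gv,\,a+b+\tfrac12\Omega(u,gv)\big)$, where $\operatorname{Sp}(V,\Omega)$ is the group of linear maps preserving $\Omega$. Its Lie algebra is $\mathfrak{jac}(V,\Omega)=\mathfrak{sp}(V,\Omega)\times V\times\mathbb{R}\ni(\mathcal{S}_2,\mathcal{S}_1,\mathcal{S}_0)$ with bracket $[(\mathcal{S}_2,\mathcal{S}_1,\mathcal{S}_0),(\mathcal{S}'_2,\mathcal{S}'_1,\mathcal{S}'_0)]=([\mathcal{S}_2,\mathcal{S}_2'],\mathcal{S}_2\mathcal{S}_1'-\mathcal{S}_2'\mathcal{S}_1,\Omega(\mathcal{S}_1,\mathcal{S}_1'))$. $\operatorname{Jac}(\mathbb{R}^{2k},-\bar{\mathbb{N}}^{-1})$ is the case $V=\mathbb{R}^{2k}$, $\Omega(u,v)=u^T(-\bar{\mathbb{N}}^{-1})v$. Elements of $\mathbb{R}^{2k}$ are column vectors; $S_1$ is a row vector. $\gamma^{-1}\dot\gamma$ denotes the left logarithmic derivative, i.e. the left translate of $\dot\gamma$ to the identity. The metric "given at the identity by $\ell$" is the left invariant metric $\langle\!\langle\cdot,\cdot\rangle\!\rangle$ with $\ell(\xi)=\frac12\langle\!\langle\xi,\xi\rangle\!\rangle$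 at the identity. *)

theory Defs
  imports "HOL-Analysis.Analysis"
begin

text \<open>
  Smoothness on an open set: all iterated directional derivatives of the Frechet derivative exist
  and are continuous. The recursion is on directional derivatives, so that the type of the
  function does not change.
\<close>

primrec Ck_on :: "nat \<Rightarrow> ('a::real_normed_vector \<Rightarrow> 'b::real_normed_vector) \<Rightarrow> 'a set \<Rightarrow> bool" where
  "Ck_on 0 f S \<longleftrightarrow> continuous_on S f"
| "Ck_on (Suc n) f S \<longleftrightarrow>
     (\<forall>x\<in>S. f differentiable (at x)) \<and> (\<forall>v. Ck_on n (\<lambda>x. frechet_derivative f (at x) v) S)"

definition smooth_on :: "('a::real_normed_vector \<Rightarrow> 'b::real_normed_vector) \<Rightarrow> 'a set \<Rightarrow> bool" where
  "smooth_on f S \<longleftrightarrow> (\<forall>n. Ck_on n f S)"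


text \<open>
  A manifold is represented by an embedded submanifold \<open>M\<close> of a normed space, so that smooth maps
  into \<open>M\<close> are the smooth maps into the ambient space with values in \<open>M\<close>, and tangent vectors
  are ambient vectors. A metric \<open>G\<close> assigns to each point a bilinear form on (at least) the tangent
  space. All curves are parametrised by open intervals \<open>T\<close>.
\<close>

definition smooth_curve_in :: "'a::real_normed_vector set \<Rightarrow> real set \<Rightarrow> (real \<Rightarrow> 'a) \<Rightarrow> bool" where
  "smooth_curve_in M T c \<longleftrightarrow> smooth_on c T \<and> (\<forall>t\<in>T. c t \<in> M)"

definition energy ::
  "('a::real_normed_vector \<Rightarrow> 'a \<Rightarrow> 'a \<Rightarrow> real) \<Rightarrow> real \<Rightarrow> real \<Rightarrow> (real \<Rightarrow> 'a) \<Rightarrow> real" where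
  "energy G a b c =
     integral {a..b}
       (\<lambda>t. G (c t) (vector_derivative c (at t)) (vector_derivative c (at t)) / 2)"

text \<open>Smooth variations of \<open>c\<close> within \<open>M\<close> with parameter \<open>\<bar>s\<bar> < \<epsilon>\<close>, fixing the values at \<open>a\<close> and \<open>b\<close>.\<close>

definition proper_variation ::
  "'a::real_normed_vector set \<Rightarrow> real set \<Rightarrow> (real \<Rightarrow> 'a) \<Rightarrow> real \<Rightarrow> real \<Rightarrow> real \<Rightarrow>
     (real \<Rightarrow> real \<Rightarrow> 'a) \<Rightarrow> bool" where
  "proper_variation M T c a b \<epsilon> \<Gamma> \<longleftrightarrow>
     smooth_on (\<lambda>(s, t). \<Gamma> s t) ({-\<epsilon><..<\<epsilon>} \<times> T) \<and>
     (\<forall>s\<in>{-\<epsilon><..<\<epsilon>}. \<forall>t\<in>T. \<Gamma> s t \<in> M) \<and>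
     (\<forall>t\<in>T. \<Gamma> 0 t = c t) \<and>
     (\<forall>s\<in>{-\<epsilon><..<\<epsilon>}. \<Gamma> s a = c a \<and> \<Gamma> s b = c b)"

text \<open>
  Geodesics are the smooth curves whose restriction to every compact subinterval is a critical
  point of the energy (the action of the kinetic energy Lagrangian) for variations with fixed
  end points.
\<close>

definition geodesic ::
  "'a::real_normed_vector set \<Rightarrow> ('a \<Rightarrow> 'a \<Rightarrow> 'a \<Rightarrow> real) \<Rightarrow> real set \<Rightarrow> (real \<Rightarrow> 'a) \<Rightarrow> bool" where
  "geodesic M G T c \<longleftrightarrow>
     smooth_curve_in M T c \<and>
     (\<forall>a b \<epsilon> \<Gamma>. a < b \<and> {a..b} \<subseteq> T \<and> \<epsilon> > 0 \<and> proper_variation M T c a b \<epsilon> \<Gamma> \<longrightarrow>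
        ((\<lambda>s. energy G a b (\<Gamma> s)) has_real_derivative 0) (at 0))"


text \<open>
  The Jacobi group of \<open>(V, \<Omega>)\<close> for \<open>V\<close> a coordinate space, linear maps being matrices. The
  operations are defined on all of the ambient vector space.
\<close>

type_synonym 'm jac = "(real^'m^'m) \<times> (real^'m) \<times> real"

definition Sp :: "(real^'m \<Rightarrow> real^'m \<Rightarrow> real) \<Rightarrow> (real^'m^'m) set" where
  "Sp \<Omega> = {g. \<forall>u v. \<Omega> (g *v u) (g *v v) = \<Omega> u v}"

definition Jac :: "(real^'m \<Rightarrow> real^'m \<Rightarrow> real) \<Rightarrow> ('m::finite) jac set" where
  "Jac \<Omega> = Sp \<Omega> \<times> UNIV \<times> UNIV"

fun jac_mult :: "(real^'m \<Rightarrow> real^'m \<Rightarrow> real) \<Rightarrow> ('m::finite) jac \<Rightarrow> 'm jac \<Rightarrow> 'm jac" where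
  "jac_mult \<Omega> (g, u, a) (h, v, b) = (g ** h, u + g *v v, a + b + \<Omega> u (g *v v) / 2)"

fun jac_inv :: "('m::finite) jac \<Rightarrow> 'm jac" where
  "jac_inv (g, u, a) = (matrix_inv g, - (matrix_inv g *v u), - a)"

definition sp_algebra :: "(real^'m \<Rightarrow> real^'m \<Rightarrow> real) \<Rightarrow> (real^'m^'m) set" where
  "sp_algebra \<Omega> = {A. \<forall>u v. \<Omega> (A *v u) v + \<Omega> u (A *v v) = 0}"

definition jac_algebra :: "(real^'m \<Rightarrow> real^'m \<Rightarrow> real) \<Rightarrow> ('m::finite) jac set" where
  "jac_algebra \<Omega> = sp_algebra \<Omega> \<times> UNIV \<times> UNIV"

text \<open>The left translate to the identity of a vector \<open>w\<close> tangent at \<open>p\<close>.\<close>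

definition to_identity ::
  "(real^'m \<Rightarrow> real^'m \<Rightarrow> real) \<Rightarrow> ('m::finite) jac \<Rightarrow> 'm jac \<Rightarrow> 'm jac" where
  "to_identity \<Omega> p w = frechet_derivative (jac_mult \<Omega> (jac_inv p)) (at p) w"

definition left_log_deriv ::
  "(real^'m \<Rightarrow> real^'m \<Rightarrow> real) \<Rightarrow> (real \<Rightarrow> ('m::finite) jac) \<Rightarrow> real \<Rightarrow> 'm jac" where
  "left_log_deriv \<Omega> c t = to_identity \<Omega> (c t) (vector_derivative c (at t))"

text \<open>
  The left invariant metric whose quadratic form at the identity is \<open>2 l\<close>: the inner product
  at the identity is the polarisation of \<open>l\<close>.
\<close>

definition polar :: "('a::ab_group_add \<Rightarrow> real) \<Rightarrow> 'a \<Rightarrow> 'a \<Rightarrow> real" where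
  "polar l \<xi> \<eta> = l (\<xi> + \<eta>) - l \<xi> - l \<eta>"

definition left_invariant_metric ::
  "(real^'m \<Rightarrow> real^'m \<Rightarrow> real) \<Rightarrow> (('m::finite) jac \<Rightarrow> real) \<Rightarrow>
     'm jac \<Rightarrow> 'm jac \<Rightarrow> 'm jac \<Rightarrow> real" where
  "left_invariant_metric \<Omega> l p w w' = polar l (to_identity \<Omega> p w) (to_identity \<Omega> p w')"


definition matrix_form :: "real^'m^'m \<Rightarrow> real^'m \<Rightarrow> real^'m \<Rightarrow> real" where
  "matrix_form W u v = u \<bullet> (W *v v)"

fun kinetic :: "real^'m^'m \<Rightarrow> ('m::finite) jac \<Rightarrow> real" where
  "kinetic Nb (S2, S1, S0) =
     (let K = - (matrix_inv Nb ** matrix_inv Nb)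
      in trace (transpose S2 ** K ** S2) / 2 + S1 \<bullet> (K *v S1) + 2 * S0\<^sup>2)"

text \<open>
  The matrix with blocks \<open>A\<close>, \<open>b\<close> (column), \<open>c\<close> (row), \<open>d\<close>; the index \<open>None\<close> is the last one.
\<close>

definition block_matrix ::
  "real^'m^'m \<Rightarrow> real^'m \<Rightarrow> real^'m \<Rightarrow> real \<Rightarrow> real^('m::finite option)^('m option)" where
  "block_matrix A b c d =
     (\<chi> i j. case i of
        Some p \<Rightarrow> (case j of Some q \<Rightarrow> A $ p $ q | None \<Rightarrow> b $ p)
      | None \<Rightarrow> (case j of Some q \<Rightarrow> c $ q | None \<Rightarrow> d))"

fun jac_to_sym :: "real^'m^'m \<Rightarrow> 'm jac \<Rightarrow> real^('m::finite option)^('m option)" where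
  "jac_to_sym Nb (S2, S1, S0) =
     block_matrix (matrix_inv Nb ** S2) (matrix_inv Nb *v S1) (matrix_inv Nb *v S1) (2 * S0)"

definition commutator :: "real^'n^'n \<Rightarrow> real^'n^'n \<Rightarrow> real^'n^'n" where
  "commutator A B = A ** B - B ** A"

text \<open>
  \<open>Q\<close> has as columns an orthonormal basis in which \<open>N\<close> is block diagonal with blocks
  an invertible antisymmetric \<open>Nb\<close> and \<open>0\<close>.
\<close>

definition corank1_normal_form ::
  "real^('m::finite option)^('m option) \<Rightarrow> real^('m option)^('m option) \<Rightarrow> real^'m^'m \<Rightarrow> bool" where
  "corank1_normal_form N Q Nb \<longleftrightarrow>
     orthogonal_matrix Q \<and> transpose Nb = - Nb \<and> invertible Nb \<and>
     transpose Q ** N ** Q = block_matrix Nb 0 0 0"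

end

theory Submission
  imports Defs
begin

text \<open>
  Let \<open>\<xi>\<close> be the left logarithmic derivative of a curve \<open>\<gamma>\<close>, and \<open>\<eta>\<close> that of a variation of \<open>\<gamma>\<close>. By the
  Maurer--Cartan equation \<open>\<partial>\<^sub>s \<xi> = \<partial>\<^sub>t \<eta> + [\<xi>, \<eta>]\<close>, so after an integration by parts the first variation
  of the energy is the integral of \<open>\<langle>\<xi>, [\<xi>, \<eta>]\<rangle> - \<langle>\<xi>', \<eta>\<rangle>\<close>. Written in terms of \<open>S\<^sub>2, S\<^sub>1, S\<^sub>0\<close> and paired with
  symmetric matrices, the vanishing of this integrand for all \<open>\<eta>\<close> is the Bloch--Iserles equation.
  Since symmetric matrices are determined by their values \<open>v\<^sup>T M v\<close>, it suffices to test with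
  \<open>\<eta> = (t - a) (b - t) (Nb v v\<^sup>T, y, w)\<close>; such an \<open>\<eta>\<close> comes from a variation by symplectic
  transvections, which is explicit and affine in the parameter.
\<close>

section \<open>Smooth maps\<close>

text \<open>The kinetic energy is half the squared entrywise norm of the block matrix: for X and Y
  the images of \<xi> and \<eta> under \<open>jac_to_sym Nb\<close>,
  \<open>polar (kinetic Nb)\<close> is the sum of the products of their entries. This is where the
  coefficients 1/2, 1 and 2 come from. For \<xi> and \<eta> in the Lie algebra the integrand becomes
  minus the inner product of X' - [X^2, N0] with Y, where N0 is the block form of N. The obstacle is
  calculus on a group that is only a subset of a vector space. On the symplectic group, inversion
  agrees with a map linear in g, so the logarithmic derivative extends to an ambient expression made
  of a linear and a bilinear part. Variations can then be differentiated in a normed space; tangency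
  to the group is used to recognise the antisymmetrised bilinear part as the Lie bracket and to
  place the logarithmic derivatives in the Lie algebra.\<close>

lemma Ck_on_cong:
  assumes "open S" and "\<And>x. x \<in> S \<Longrightarrow> f x = g x" and "Ck_on n f S"
  shows "Ck_on n g S"
  using assms(2,3)
proof (induction n arbitrary: f g)
  case 0
  then show ?case by (auto cong: continuous_on_cong)
next
  case (Suc n)
  have der: "(g has_derivative frechet_derivative f (at x)) (at x)" if "x \<in> S" for x
  proof (rule has_derivative_transform_within_open[OF _ \<open>open S\<close> that Suc.prems(1)])
    show "(f has_derivative frechet_derivative f (at x)) (at x)"
      using Suc.prems(2) that frechet_derivative_works by fastforce
  qed
  have fr: "frechet_derivative f (at x) v = frechet_derivative g (at x) v" if "x \<in> S" for x v
    using frechet_derivative_at[OF der[OF that]] by simp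
  show ?case
    unfolding Ck_on.simps
  proof (intro conjI ballI allI)
    show "g differentiable at x" if "x \<in> S" for x
      using der[OF that] by (rule differentiableI)
    show "Ck_on n (\<lambda>x. frechet_derivative g (at x) v) S" for v
      by (rule Suc.IH[OF fr]) (use Suc.prems(2) in auto)
  qed
qed

text \<open>The recursion of \<open>Ck_on\<close> refers to \<open>frechet_derivative\<close>;
  through this rule the inductions below can work with an explicit derivative formula
  instead.\<close>

lemma Ck_on_SucI:
  assumes "open S" and "\<And>x. x \<in> S \<Longrightarrow> (f has_derivative f' x) (at x)"
    and "\<And>v. Ck_on n (\<lambda>x. f' x v) S"
  shows "Ck_on (Suc n) f S"
proof -
  have "frechet_derivative f (at x) = f' x" if "x \<in> S" for x
    by (rule frechet_derivative_at[symmetric, OF assms(2)[OF that]])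
  then show ?thesis
    using assms by (auto simp: differentiable_def intro: Ck_on_cong[OF \<open>open S\<close> _ assms(3)])
qed

text \<open>Lower orders are not part of the recursion and have to be recovered from
  differentiability. The product rule needs this, since its summands contain the undifferentiated
  factors.\<close>

lemma Ck_on_SucD:
  assumes "Ck_on (Suc n) f S"
  shows "Ck_on n f S"
  using assms
proof (induction n arbitrary: f)
  case 0
  then show ?case
    by (auto intro!: continuous_at_imp_continuous_on differentiable_imp_continuous_within)
next
  case (Suc n)
  then show ?case by (metis Ck_on.simps(2))
qed

lemma Ck_on_has_derivative:
  assumes "Ck_on (Suc n) f S" and "x \<in> S"
  shows "(f has_derivative frechet_derivative f (at x)) (at x)"
  using assms by (auto simp: frechet_derivative_works)

lemma Ck_on_bounded_linear:
  assumes "bounded_linear L" and "open S" and "Ck_on n f S"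
  shows "Ck_on n (\<lambda>x. L (f x)) S"
  using assms(3)
proof (induction n arbitrary: f)
  case 0
  then show ?case
    using bounded_linear.continuous_on[OF assms(1)] by auto
next
  case (Suc n)
  show ?case
    by (rule Ck_on_SucI[OF \<open>open S\<close> bounded_linear.has_derivative[OF assms(1) Ck_on_has_derivative[OF Suc.prems]]])
      (use Suc in auto)
qed

lemma Ck_on_add:
  assumes "open S" and "Ck_on n f S" and "Ck_on n g S"
  shows "Ck_on n (\<lambda>x. f x + g x) S"
  using assms(2,3)
proof (induction n arbitrary: f g)
  case 0
  then show ?case by (auto intro: continuous_intros)
next
  case (Suc n)
  show ?case
    by (rule Ck_on_SucI[OF \<open>open S\<close> has_derivative_add[OF Ck_on_has_derivative[OF Suc.prems(1)] Ck_on_has_derivative[OF Suc.prems(2)]]])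
      (use Suc in auto)
qed

text \<open>Each directional derivative is a sum of two terms of the same bilinear shape, so the
  induction runs over all pairs of functions at once.\<close>

lemma Ck_on_bounded_bilinear:
  assumes "bounded_bilinear B" and "open S" and "Ck_on n f S" and "Ck_on n g S"
  shows "Ck_on n (\<lambda>x. B (f x) (g x)) S"
  using assms(3,4)
proof (induction n arbitrary: f g)
  case 0
  then show ?case
    using bounded_bilinear.continuous_on[OF assms(1)] by auto
next
  case (Suc n)
  show ?case
    by (rule Ck_on_SucI[OF \<open>open S\<close> bounded_bilinear.FDERIV[OF assms(1) Ck_on_has_derivative[OF Suc.prems(1)] Ck_on_has_derivative[OF Suc.prems(2)]]])
      (use Suc Suc.prems[THEN Ck_on_SucD] in \<open>auto intro!: Ck_on_add \<open>open S\<close>\<close>)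
qed

lemma Ck_on_const:
  assumes "open S"
  shows "Ck_on n (\<lambda>x. c) S"
proof (induction n arbitrary: c)
  case (Suc n)
  show ?case
    by (rule Ck_on_SucI[OF assms has_derivative_const]) (rule Suc)
qed simp

lemma Ck_on_linear:
  assumes "bounded_linear L" and "open S"
  shows "Ck_on n L S"
proof (cases n)
  case (Suc m)
  then show ?thesis
    using assms bounded_linear_imp_has_derivative[OF assms(1)] Ck_on_const[OF \<open>open S\<close>]
      Ck_on_SucI[where f = L and f' = "\<lambda>x. L" and S = S and n = m] by blast
qed (simp add: linear_continuous_on assms(1))

text \<open>The derivative of a function of the second coordinate in a fixed direction is again of
  this kind, so the induction closes without a general chain rule. It is used to view a curve as a
  variation constant in the parameter.\<close>

lemma Ck_on_comp_snd:
  fixes f :: "'b::real_normed_vector \<Rightarrow> 'c::real_normed_vector"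
    and U :: "'a::real_normed_vector set"
  assumes "open U" and "open S" and "Ck_on n f S"
  shows "Ck_on n (\<lambda>x. f (snd x)) (U \<times> S)"
  using assms(3)
proof (induction n arbitrary: f)
  case 0
  then show ?case
    by (auto intro!: continuous_on_compose2[of S f] continuous_intros)
next
  case (Suc n)
  have "((\<lambda>x. f (snd x)) has_derivative (\<lambda>h. frechet_derivative f (at (snd x)) (snd h))) (at x)"
    if "x \<in> U \<times> S" for x :: "'a \<times> 'b"
    using that Ck_on_has_derivative[OF Suc.prems, of "snd x"]
    by (intro has_derivative_compose[of snd snd x UNIV f])
      (auto intro!: derivative_eq_intros)
  then show ?case
    using Suc.prems assms(1,2)
    by (intro Ck_on_SucI[where f' = "\<lambda>x h. frechet_derivative f (at (snd x)) (snd h)"] open_Times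
        Suc.IH[of "\<lambda>y. frechet_derivative f (at y) v" for v]) auto
qed

section \<open>Partial derivatives of smooth maps of two real variables\<close>

lemma smooth_on_frechet:
  assumes "smooth_on f S"
  shows "smooth_on (\<lambda>x. frechet_derivative f (at x) v) S"
  using assms unfolding smooth_on_def by (metis Ck_on.simps(2))

lemma smooth_on_has_derivative:
  assumes "smooth_on f S" and "x \<in> S"
  shows "(f has_derivative frechet_derivative f (at x)) (at x)"
  using assms Ck_on_has_derivative unfolding smooth_on_def by blast

lemma smooth_on_continuous_on:
  assumes "smooth_on f S"
  shows "continuous_on S f"
  using assms unfolding smooth_on_def by (metis Ck_on.simps(1))

lemma smooth_on_partial_fst:
  fixes f :: "real \<times> real \<Rightarrow> 'a::real_normed_vector"
  assumes "smooth_on f S" and "(s, t) \<in> S"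
  shows "((\<lambda>s. f (s, t)) has_vector_derivative frechet_derivative f (at (s, t)) (1, 0)) (at s within U)"
proof -
  have "((\<lambda>s. f (s, t)) has_derivative (\<lambda>h. frechet_derivative f (at (s, t)) (h, 0))) (at s within U)"
    by (rule has_derivative_compose[where f = "\<lambda>s. (s, t)" and g = f, OF _ smooth_on_has_derivative[OF assms]])
      (auto intro!: derivative_eq_intros)
  moreover have "(\<lambda>h. frechet_derivative f (at (s, t)) (h, 0)) = (\<lambda>h. h *\<^sub>R frechet_derivative f (at (s, t)) (1, 0))"
    using linear_scale[OF has_derivative_linear[OF smooth_on_has_derivative[OF assms]], of _ "(1, 0)"]
    by (intro ext) (metis real_scaleR_def mult_1_right mult_zero_right scaleR_Pair)
  ultimately show ?thesis
    unfolding has_vector_derivative_def by (rule subst[rotated])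
qed

lemma smooth_on_partial_snd:
  fixes f :: "real \<times> real \<Rightarrow> 'a::real_normed_vector"
  assumes "smooth_on f S" and "(s, t) \<in> S"
  shows "((\<lambda>t. f (s, t)) has_vector_derivative frechet_derivative f (at (s, t)) (0, 1)) (at t within U)"
proof -
  have "((\<lambda>t. f (s, t)) has_derivative (\<lambda>h. frechet_derivative f (at (s, t)) (0, h))) (at t within U)"
    by (rule has_derivative_compose[where f = "\<lambda>t. (s, t)" and g = f, OF _ smooth_on_has_derivative[OF assms]])
      (auto intro!: derivative_eq_intros)
  moreover have "(\<lambda>h. frechet_derivative f (at (s, t)) (0, h)) = (\<lambda>h. h *\<^sub>R frechet_derivative f (at (s, t)) (0, 1))"
    using linear_scale[OF has_derivative_linear[OF smooth_on_has_derivative[OF assms]], of _ "(0, 1)"]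
    by (intro ext) (metis real_scaleR_def mult_1_right mult_zero_right scaleR_Pair)
  ultimately show ?thesis
    unfolding has_vector_derivative_def by (rule subst[rotated])
qed

text \<open>Write f(s, t) - f(p, t) as the integral of the s-derivative, differentiate under the
  integral sign in t, and then differentiate the result in s by the fundamental theorem of
  calculus.\<close>

lemma smooth_on_mixed_partials:
  fixes f :: "real \<times> real \<Rightarrow> 'a::euclidean_space"
  assumes f: "smooth_on f ({c<..<d} \<times> T)" and "open T" and "is_interval T"
    and "s0 \<in> {c<..<d}" and "t0 \<in> T"
  defines "D \<equiv> \<lambda>v f x. frechet_derivative f (at x) v"
  shows "D (1, 0) (D (0, 1) f) (s0, t0) = D (0, 1) (D (1, 0) f) (s0, t0)"
proof -
  let ?S = "{c<..<d} \<times> T"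
  \<comment> \<open>A compact interval around \<open>s0\<close> inside the open one:
    \<open>p\<close> is the base point of all the integrals, and \<open>q\<close> leaves room to the
    right of \<open>s0\<close> for a two-sided derivative.\<close>
  obtain p where p: "c < p" "p < s0" using assms(4) dense by auto
  obtain q where q: "s0 < q" "q < d" using assms(4) dense by auto
  have smo: "smooth_on (D u f) ?S" "smooth_on (D v (D u f)) ?S" for u v
    unfolding D_def by (intro smooth_on_frechet f)+
  have cont: "continuous_on A (\<lambda>s. D v (D u f) (s, t))" if "A \<subseteq> {c<..<d}" "t \<in> T" for u v A t
    using that
    by (intro continuous_on_compose2[OF smooth_on_continuous_on[OF smo(2)]] continuous_intros) auto
  have contt: "continuous_on A (\<lambda>s. D u f (s, t))" if "A \<subseteq> {c<..<d}" "t \<in> T" for u A t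
    using that
    by (intro continuous_on_compose2[OF smooth_on_continuous_on[OF smo(1)]] continuous_intros) auto
  have 1: "integral (cbox p s) (\<lambda>\<sigma>. D (1, 0) f (\<sigma>, t)) = f (s, t) - f (p, t)"
    if "s \<in> {p..q}" "t \<in> T" for s t
    unfolding cbox_interval D_def using that p q
    by (intro integral_unique fundamental_theorem_of_calculus smooth_on_partial_fst[OF f]) auto
  have 2: "((\<lambda>t. integral (cbox p s) (\<lambda>\<sigma>. D (1, 0) f (\<sigma>, t))) has_vector_derivative
      integral (cbox p s) (\<lambda>\<sigma>. D (0, 1) (D (1, 0) f) (\<sigma>, t0))) (at t0 within T)"
    if "s \<in> {p..q}" for s
  proof (rule leibniz_rule_vector_derivative[where fx = "\<lambda>t \<sigma>. D (0, 1) (D (1, 0) f) (\<sigma>, t)"])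
    show "continuous_on (T \<times> cbox p s) (\<lambda>(t, \<sigma>). D (0, 1) (D (1, 0) f) (\<sigma>, t))"
      using that p q unfolding split_beta
      by (intro continuous_on_compose2[OF smooth_on_continuous_on[OF smo(2)]] continuous_intros) auto
    show "convex T" using assms is_interval_convex by blast
    show "(\<lambda>\<sigma>. D (1, 0) f (\<sigma>, t)) integrable_on cbox p s" if "t \<in> T" for t
      using that \<open>s \<in> {p..q}\<close> p q unfolding cbox_interval
      by (intro integrable_continuous_interval contt) auto
    show "((\<lambda>t. D (1, 0) f (\<sigma>, t)) has_vector_derivative D (0, 1) (D (1, 0) f) (\<sigma>, t)) (at t within T)"
      if "t \<in> T" "\<sigma> \<in> cbox p s" for t \<sigma>
      unfolding D_def using that \<open>s \<in> {p..q}\<close> p q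
      by (intro smooth_on_partial_snd[OF smo(1)[unfolded D_def]]) auto
  qed (use assms(5) in simp)
  have 3: "integral (cbox p s) (\<lambda>\<sigma>. D (0, 1) (D (1, 0) f) (\<sigma>, t0)) = D (0, 1) f (s, t0) - D (0, 1) f (p, t0)"
    if s: "s \<in> {p..q}" for s
  proof -
    have "((\<lambda>t. f (s, t) - f (p, t)) has_vector_derivative
        integral (cbox p s) (\<lambda>\<sigma>. D (0, 1) (D (1, 0) f) (\<sigma>, t0))) (at t0)"
    proof (rule has_vector_derivative_transform_within_open[OF _ assms(2,5) 1[OF s]])
      show "((\<lambda>t. integral (cbox p s) (\<lambda>\<sigma>. D (1, 0) f (\<sigma>, t))) has_vector_derivative
        integral (cbox p s) (\<lambda>\<sigma>. D (0, 1) (D (1, 0) f) (\<sigma>, t0))) (at t0)"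
        using 2[OF s] at_within_open[OF assms(5,2)] by simp
    qed
    moreover have "((\<lambda>t. f (s, t) - f (p, t)) has_vector_derivative
        D (0, 1) f (s, t0) - D (0, 1) f (p, t0)) (at t0)"
      using s p q assms(5) unfolding D_def
      by (intro has_vector_derivative_diff smooth_on_partial_snd[OF f]) auto
    ultimately show ?thesis by (rule vector_derivative_unique_at)
  qed
  \<comment> \<open>The identity of fact 3 is differentiated at \<open>s0\<close>: the integral
    gives one mixed partial, the difference of values gives the other.\<close>
  have "((\<lambda>s. integral {p..s} (\<lambda>\<sigma>. D (0, 1) (D (1, 0) f) (\<sigma>, t0))) has_vector_derivative
      D (0, 1) (D (1, 0) f) (s0, t0)) (at s0 within {p..q})"
    using p q assms(5) by (intro integral_has_vector_derivative cont) auto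
  then have "((\<lambda>s. integral {p..s} (\<lambda>\<sigma>. D (0, 1) (D (1, 0) f) (\<sigma>, t0))) has_vector_derivative
      D (0, 1) (D (1, 0) f) (s0, t0)) (at s0)"
    using p q by (simp add: at_within_Icc_at)
  then have "((\<lambda>s. D (0, 1) f (s, t0) - D (0, 1) f (p, t0)) has_vector_derivative
      D (0, 1) (D (1, 0) f) (s0, t0)) (at s0)"
  proof (rule has_vector_derivative_transform_within_open)
    show "integral {p..s} (\<lambda>\<sigma>. D (0, 1) (D (1, 0) f) (\<sigma>, t0)) =
        D (0, 1) f (s, t0) - D (0, 1) f (p, t0)" if "s \<in> {p<..<q}" for s
      using 3[of s] that by (simp add: cbox_interval)
  qed (use p q in auto)
  moreover have "((\<lambda>s. D (0, 1) f (s, t0) - D (0, 1) f (p, t0)) has_vector_derivative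
      D (1, 0) (D (0, 1) f) (s0, t0) - 0) (at s0)"
    unfolding D_def using assms(4,5)
    by (intro has_vector_derivative_diff smooth_on_partial_fst[OF smo(1)[unfolded D_def]] has_vector_derivative_const) auto
  ultimately show ?thesis
    using vector_derivative_unique_at by fastforce
qed

lemma smooth_on_bounded_linear:
  "bounded_linear L \<Longrightarrow> open S \<Longrightarrow> smooth_on f S \<Longrightarrow> smooth_on (\<lambda>x. L (f x)) S"
  by (simp add: smooth_on_def Ck_on_bounded_linear)

lemma smooth_on_add:
  "open S \<Longrightarrow> smooth_on f S \<Longrightarrow> smooth_on g S \<Longrightarrow> smooth_on (\<lambda>x. f x + g x) S"
  by (simp add: smooth_on_def Ck_on_add)

lemma smooth_on_bounded_bilinear:
  "bounded_bilinear B \<Longrightarrow> open S \<Longrightarrow> smooth_on f S \<Longrightarrow> smooth_on g S \<Longrightarrow>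
    smooth_on (\<lambda>x. B (f x) (g x)) S"
  by (simp add: smooth_on_def Ck_on_bounded_bilinear)

lemma smooth_on_const: "open S \<Longrightarrow> smooth_on (\<lambda>x. c) S"
  by (simp add: smooth_on_def Ck_on_const)

lemma smooth_on_linear: "bounded_linear L \<Longrightarrow> open S \<Longrightarrow> smooth_on L S"
  by (simp add: smooth_on_def Ck_on_linear)

lemma smooth_on_comp_snd:
  "open U \<Longrightarrow> open S \<Longrightarrow> smooth_on f S \<Longrightarrow> smooth_on (\<lambda>x. f (snd x)) (U \<times> S)"
  by (simp add: smooth_on_def Ck_on_comp_snd)

lemma smooth_on_cong:
  "open S \<Longrightarrow> (\<And>x. x \<in> S \<Longrightarrow> f x = g x) \<Longrightarrow> smooth_on f S \<Longrightarrow> smooth_on g S"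
  unfolding smooth_on_def using Ck_on_cong by blast

lemma smooth_on_has_vector_derivative:
  fixes f :: "real \<Rightarrow> 'a::real_normed_vector"
  assumes "smooth_on f S" and "t \<in> S"
  shows "(f has_vector_derivative frechet_derivative f (at t) 1) (at t)"
proof -
  note der = smooth_on_has_derivative[OF assms]
  have "frechet_derivative f (at t) = (\<lambda>h. h *\<^sub>R frechet_derivative f (at t) 1)"
    using linear_scale[OF has_derivative_linear[OF der], of _ 1]
    by (intro ext) (metis real_scaleR_def mult_1_right)
  with der show ?thesis
    unfolding has_vector_derivative_def by (rule subst[rotated])
qed

lemma smooth_on_Pair:
  assumes "open S" and "smooth_on f S" and "smooth_on g S"
  shows "smooth_on (\<lambda>x. (f x, g x)) S"
proof -
  have "bounded_linear (\<lambda>y::'b. (y, 0::'c))" "bounded_linear (\<lambda>y::'c. (0::'b, y))"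
    by (intro bounded_linear_Pair bounded_linear_ident bounded_linear_zero)+
  from smooth_on_add[OF assms(1) smooth_on_bounded_linear[OF this(1) assms(1,2)]
      smooth_on_bounded_linear[OF this(2) assms(1,3)]]
  show ?thesis by simp
qed

section \<open>The first variation\<close>

text \<open>Only the weights \<open>(t - a) (b - t)\<close> are tested, so no bump functions are needed later on.\<close>

lemma fundamental_lemma_quadratic_weight:
  fixes f :: "real \<Rightarrow> real"
  assumes "open T" and f: "continuous_on T f" and "t0 \<in> T"
    and int0: "\<And>a b. a < b \<Longrightarrow> {a..b} \<subseteq> T \<Longrightarrow> integral {a..b} (\<lambda>t. (t - a) * (b - t) * f t) = 0"
  shows "f t0 = 0"
proof (rule ccontr)
  assume ne: "f t0 \<noteq> 0"
  \<comment> \<open>The sign is normalised so that \<open>g\<close> is positive at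
    \<open>t0\<close>.\<close>
  define g where "g = (\<lambda>t. sgn (f t0) * f t)"
  have g0: "g t0 > 0" using ne by (simp add: g_def sgn_real_def)
  have "continuous_on T g" unfolding g_def by (intro continuous_intros f)
  then have "open (T \<inter> g -` {0<..})" using \<open>open T\<close> continuous_on_open_vimage
    by (metis open_greaterThan inf_commute)
  then obtain d where d: "d > 0" "cball t0 d \<subseteq> T \<inter> g -` {0<..}"
    using open_contains_cball \<open>t0 \<in> T\<close> g0 by (metis IntI greaterThan_iff vimageI)
  \<comment> \<open>On this interval \<open>g\<close> is positive and the weight is nonnegative,
    with a positive value at the centre \<open>t0\<close>. A zero integral is therefore
    impossible.\<close>
  let ?a = "t0 - d" and ?b = "t0 + d"
  have sub: "{?a..?b} \<subseteq> T" and pos: "\<And>t. t \<in> {?a..?b} \<Longrightarrow> g t > 0"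
    using d by (auto simp: cball_eq_atLeastAtMost)
  let ?h = "\<lambda>t. (t - ?a) * (?b - t) * g t"
  have "integral {?a..?b} ?h = sgn (f t0) * integral {?a..?b} (\<lambda>t. (t - ?a) * (?b - t) * f t)"
    unfolding integral_mult_right[symmetric] g_def by (rule integral_cong) simp
  also have "\<dots> = 0" using int0[OF _ sub] d by simp
  finally have "integral {?a..?b} ?h = 0" .
  moreover have "continuous_on {?a..?b} ?h" unfolding g_def
    by (intro continuous_intros continuous_on_subset[OF f sub])
  moreover have "?h t \<ge> 0" if "t \<in> {?a..?b}" for t
    using that pos[OF that] by (intro mult_nonneg_nonneg less_imp_le[OF pos[OF that]]) auto
  moreover have "?a < ?b" using d by simp
  ultimately have "\<forall>t\<in>{?a..?b}. ?h t = 0"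
    using integral_eq_0_iff[of ?a ?b ?h] by blast
  moreover have "t0 \<in> {?a..?b}" using d by simp
  ultimately have "?h t0 = 0" by blast
  then show False using g0 d by simp
qed

text \<open>No group is involved: \<Xi> and H are the same expression in \<open>lam\<close> and
  \<open>beta\<close>, applied to the two partial derivatives of F. In the s-derivative of \<Xi>
  minus the t-derivative of H the second derivatives of F cancel by symmetry, and the
  antisymmetrised \<open>beta\<close> survives. For the Maurer--Cartan form this is the structure
  equation.\<close>

lemma first_variation_integral:
  fixes F :: "real \<times> real \<Rightarrow> 'v::euclidean_space"
    and q :: "'v \<Rightarrow> 'v \<Rightarrow> real"
  assumes F: "smooth_on F ({-\<epsilon><..<\<epsilon>} \<times> T)" and "\<epsilon> > 0" and T: "open T" "is_interval T"
    and ab: "a < b" "{a..b} \<subseteq> T"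
    and lam: "bounded_linear lam" and beta: "bounded_bilinear beta"
    and q: "bounded_bilinear q" and q_sym: "\<And>v w. q v w = q w v"
  defines "D \<equiv> \<lambda>v f x. frechet_derivative f (at x) v"
  defines "\<Xi> \<equiv> \<lambda>x. lam (D (0, 1) F x) + beta (F x) (D (0, 1) F x)"
    and "H \<equiv> \<lambda>x. lam (D (1, 0) F x) + beta (F x) (D (1, 0) F x)"
  assumes H0: "H (0, a) = 0" "H (0, b) = 0"
    and \<xi>': "\<And>t. t \<in> T \<Longrightarrow> ((\<lambda>t. \<Xi> (0, t)) has_vector_derivative \<xi>' t) (at t)"
  shows "((\<lambda>s. integral {a..b} (\<lambda>t. q (\<Xi> (s, t)) (\<Xi> (s, t)) / 2)) has_real_derivative
      integral {a..b} (\<lambda>t. q (\<Xi> (0, t)) (beta (D (1, 0) F (0, t)) (D (0, 1) F (0, t)) -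
        beta (D (0, 1) F (0, t)) (D (1, 0) F (0, t))) - q (\<xi>' t) (H (0, t)))) (at 0)"
proof -
  let ?I = "{-\<epsilon><..<\<epsilon>}" and ?S = "{-\<epsilon><..<\<epsilon>} \<times> T"
  have S: "open ?S" using T by (intro open_Times) auto
  have DF: "smooth_on (D v F) ?S" for v unfolding D_def by (rule smooth_on_frechet[OF F])
  have sm: "smooth_on \<Xi> ?S" "smooth_on H ?S" unfolding \<Xi>_def H_def
    by (intro smooth_on_add smooth_on_bounded_linear[OF lam] smooth_on_bounded_bilinear[OF beta] S DF F)+
  have Dsm: "smooth_on (D v \<Xi>) ?S" "smooth_on (D v H) ?S" for v
    unfolding D_def by (rule smooth_on_frechet, rule sm)+
  have p1: "((\<lambda>s. f (s, t)) has_vector_derivative D (1, 0) f (s, t)) (at s within U)"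
    and p2: "((\<lambda>t. f (s, t)) has_vector_derivative D (0, 1) f (s, t)) (at t within U)"
    if "smooth_on f ?S" "(s, t) \<in> ?S" for f :: "real \<times> real \<Rightarrow> 'v" and s t U
    unfolding D_def by (rule smooth_on_partial_fst[OF that] smooth_on_partial_snd[OF that])+
  note hd [derivative_intros] = bounded_linear.has_vector_derivative[OF lam]
    bounded_bilinear.has_vector_derivative[OF beta] bounded_bilinear.has_vector_derivative[OF q]
  have D1\<Xi>: "D (1, 0) \<Xi> (s, t) = lam (D (1, 0) (D (0, 1) F) (s, t)) +
      (beta (F (s, t)) (D (1, 0) (D (0, 1) F) (s, t)) + beta (D (1, 0) F (s, t)) (D (0, 1) F (s, t)))"
    if "(s, t) \<in> ?S" for s t
  proof (rule vector_derivative_unique_at)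
    show "((\<lambda>s. \<Xi> (s, t)) has_vector_derivative D (1, 0) \<Xi> (s, t)) (at s)"
      by (rule p1[OF sm(1) that])
    show "((\<lambda>s. \<Xi> (s, t)) has_vector_derivative lam (D (1, 0) (D (0, 1) F) (s, t)) +
      (beta (F (s, t)) (D (1, 0) (D (0, 1) F) (s, t)) + beta (D (1, 0) F (s, t)) (D (0, 1) F (s, t)))) (at s)"
      unfolding \<Xi>_def
      by (intro has_vector_derivative_add hd p1[OF DF that] p1[OF F that])
  qed
  have D2H: "D (0, 1) H (s, t) = lam (D (0, 1) (D (1, 0) F) (s, t)) +
      (beta (F (s, t)) (D (0, 1) (D (1, 0) F) (s, t)) + beta (D (0, 1) F (s, t)) (D (1, 0) F (s, t)))"
    if "(s, t) \<in> ?S" for s t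
  proof (rule vector_derivative_unique_at)
    show "((\<lambda>t. H (s, t)) has_vector_derivative D (0, 1) H (s, t)) (at t)"
      by (rule p2[OF sm(2) that])
    show "((\<lambda>t. H (s, t)) has_vector_derivative lam (D (0, 1) (D (1, 0) F) (s, t)) +
      (beta (F (s, t)) (D (0, 1) (D (1, 0) F) (s, t)) + beta (D (0, 1) F (s, t)) (D (1, 0) F (s, t)))) (at t)"
      unfolding H_def
      by (intro has_vector_derivative_add hd p2[OF DF that] p2[OF F that])
  qed
  let ?C = "\<lambda>t. beta (D (1, 0) F (0, t)) (D (0, 1) F (0, t)) - beta (D (0, 1) F (0, t)) (D (1, 0) F (0, t))"
  have zero: "0 \<in> ?I" using \<open>\<epsilon> > 0\<close> by simp
  have mixed: "D (1, 0) \<Xi> (0, t) = D (0, 1) H (0, t) + ?C t" if "t \<in> T" for t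
  proof -
    have "D (1, 0) (D (0, 1) F) (0, t) = D (0, 1) (D (1, 0) F) (0, t)"
      unfolding D_def by (rule smooth_on_mixed_partials[OF F T zero that])
    then show ?thesis using D1\<Xi>[of 0 t] D2H[of 0 t] that zero by simp
  qed
  have cq: "continuous_on A (\<lambda>x. q (f x) (g x))" if "continuous_on A f" "continuous_on A g" for A f g
    using bounded_bilinear.continuous_on[OF q that] .
  have co: "continuous_on {a..b} (\<lambda>t. f (s, t))" if "smooth_on f ?S" "s \<in> ?I" for f :: "real \<times> real \<Rightarrow> 'v" and s
    using that ab
    by (intro continuous_on_compose2[OF smooth_on_continuous_on[OF that(1)]] continuous_intros) auto
  have "((\<lambda>s. integral (cbox a b) (\<lambda>t. q (\<Xi> (s, t)) (\<Xi> (s, t)) / 2)) has_vector_derivative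
      integral (cbox a b) (\<lambda>t. q (\<Xi> (0, t)) (D (1, 0) \<Xi> (0, t)))) (at 0 within ?I)"
  proof (rule leibniz_rule_vector_derivative[where fx = "\<lambda>s t. q (\<Xi> (s, t)) (D (1, 0) \<Xi> (s, t))"])
    show "((\<lambda>s. q (\<Xi> (s, t)) (\<Xi> (s, t)) / 2) has_vector_derivative
        q (\<Xi> (s, t)) (D (1, 0) \<Xi> (s, t))) (at s within ?I)"
      if "s \<in> ?I" "t \<in> cbox a b" for s t
    proof -
      have st: "(s, t) \<in> ?S" using that ab by auto
      have "((\<lambda>s. q (\<Xi> (s, t)) (\<Xi> (s, t))) has_vector_derivative
          q (\<Xi> (s, t)) (D (1, 0) \<Xi> (s, t)) + q (D (1, 0) \<Xi> (s, t)) (\<Xi> (s, t))) (at s within ?I)"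
        by (intro hd p1[OF sm(1) st])
      from has_vector_derivative_mult_right[OF this, of "1/2"] show ?thesis
        by (simp add: q_sym[of "D (1, 0) \<Xi> (s, t)"])
    qed
    show "(\<lambda>t. q (\<Xi> (s, t)) (\<Xi> (s, t)) / 2) integrable_on cbox a b" if "s \<in> ?I" for s
      unfolding cbox_interval
      by (intro integrable_continuous_interval continuous_intros cq co sm that) auto
    show "continuous_on (?I \<times> cbox a b) (\<lambda>(s, t). q (\<Xi> (s, t)) (D (1, 0) \<Xi> (s, t)))"
      unfolding split_beta prod.collapse using ab
      by (intro cq continuous_on_subset[OF smooth_on_continuous_on[OF sm(1)]]
          continuous_on_subset[OF smooth_on_continuous_on[OF Dsm(1)]]) auto
  qed (use zero in auto)
  then have A: "((\<lambda>s. integral {a..b} (\<lambda>t. q (\<Xi> (s, t)) (\<Xi> (s, t)) / 2)) has_real_derivative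
      integral {a..b} (\<lambda>t. q (\<Xi> (0, t)) (D (1, 0) \<Xi> (0, t)))) (at 0)"
    unfolding has_real_derivative_iff_has_vector_derivative cbox_interval[symmetric]
      at_within_open[OF zero open_greaterThanLessThan] .
  have \<xi>'_eq: "\<xi>' t = D (0, 1) \<Xi> (0, t)" if "t \<in> T" for t
    using vector_derivative_unique_at[OF \<xi>'[OF that] p2[OF sm(1)]] that zero by simp
  have "((\<lambda>t. q (\<Xi> (0, t)) (D (0, 1) H (0, t)) + q (D (0, 1) \<Xi> (0, t)) (H (0, t))) has_integral
      q (\<Xi> (0, b)) (H (0, b)) - q (\<Xi> (0, a)) (H (0, a))) {a..b}"
    using ab zero
    by (intro fundamental_theorem_of_calculus hd p2[OF sm(1)] p2[OF sm(2)]) auto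
  \<comment> \<open>Integration by parts: H vanishes at both ends, so this integral can be
    subtracted freely, which trades the t-derivative of H for that of \<Xi>.\<close>
  then have B: "integral {a..b} (\<lambda>t. q (\<Xi> (0, t)) (D (0, 1) H (0, t)) + q (D (0, 1) \<Xi> (0, t)) (H (0, t))) = 0"
    using H0 by (simp add: integral_unique bounded_bilinear.zero_right[OF q])
  have i1: "(\<lambda>t. q (\<Xi> (0, t)) (D (1, 0) \<Xi> (0, t))) integrable_on {a..b}"
    and i2: "(\<lambda>t. q (\<Xi> (0, t)) (D (0, 1) H (0, t)) + q (D (0, 1) \<Xi> (0, t)) (H (0, t))) integrable_on {a..b}"
    by (intro integrable_continuous_interval continuous_intros cq co sm Dsm zero)+
  have "integral {a..b} (\<lambda>t. q (\<Xi> (0, t)) (D (1, 0) \<Xi> (0, t))) =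
      integral {a..b} (\<lambda>t. q (\<Xi> (0, t)) (D (1, 0) \<Xi> (0, t)) -
        (q (\<Xi> (0, t)) (D (0, 1) H (0, t)) + q (D (0, 1) \<Xi> (0, t)) (H (0, t))))"
    by (simp add: integral_diff[OF i1 i2] B)
  also have "\<dots> = integral {a..b} (\<lambda>t. q (\<Xi> (0, t)) (?C t) - q (\<xi>' t) (H (0, t)))"
    using ab mixed \<xi>'_eq
    by (intro integral_cong) (auto simp: bounded_bilinear.add_right[OF q] subset_iff)
  finally show ?thesis using A by simp
qed

section \<open>Matrices\<close>

lemma bounded_bilinear_matrix_matrix_mult:
  "bounded_bilinear ((**) :: real^'n^'m \<Rightarrow> real^'k^'n \<Rightarrow> real^'k^'m)"
  unfolding bilinear_conv_bounded_bilinear[symmetric] bilinear_def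
  by (auto intro!: linearI simp: vec_eq_iff matrix_matrix_mult_def sum.distrib sum_distrib_left algebra_simps)

lemma bounded_bilinear_matrix_vector_mult:
  "bounded_bilinear ((*v) :: real^'n^'m \<Rightarrow> real^'n \<Rightarrow> real^'m)"
  unfolding bilinear_conv_bounded_bilinear[symmetric] bilinear_def
  by (auto intro!: linearI simp: vec_eq_iff matrix_vector_mult_def sum.distrib sum_distrib_left algebra_simps)

interpretation mm: bounded_bilinear "(**) :: real^'n^'m \<Rightarrow> real^'k^'n \<Rightarrow> real^'k^'m"
  by (rule bounded_bilinear_matrix_matrix_mult)

interpretation mv: bounded_bilinear "(*v) :: real^'n^'m \<Rightarrow> real^'n \<Rightarrow> real^'m"
  by (rule bounded_bilinear_matrix_vector_mult)

lemma linear_transpose: "linear (transpose :: real^'n^'m \<Rightarrow> real^'m^'n)"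
  by (auto intro!: linearI simp: vec_eq_iff transpose_def)

lemmas transpose_add = linear_add[OF linear_transpose]
  and transpose_minus = linear_neg[OF linear_transpose]
  and transpose_diff = linear_diff[OF linear_transpose]
  and transpose_scaleR = linear_scale[OF linear_transpose]

lemma trace_transpose_mult: "trace (transpose A ** B) = A \<bullet> (B :: real^'n^'m)"
  unfolding trace_def matrix_matrix_mult_def transpose_def inner_vec_def
  by simp (rule sum.swap)

lemma inner_mult_left: "A \<bullet> (M ** B) = (transpose M ** A) \<bullet> (B :: real^'n^'m)"
  by (simp add: trace_transpose_mult[symmetric] matrix_transpose_mul matrix_mul_assoc)

lemma inner_mult_right: "A \<bullet> (B ** M) = (A ** transpose M) \<bullet> (B :: real^'n^'m)"
proof -
  have "A \<bullet> (B ** M) = trace (M ** (transpose A ** B))"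
    by (subst trace_mul_sym) (simp add: trace_transpose_mult[symmetric] matrix_mul_assoc)
  then show ?thesis
    by (simp add: trace_transpose_mult[symmetric] matrix_transpose_mul matrix_mul_assoc)
qed

lemma inner_transpose: "transpose A \<bullet> transpose B = A \<bullet> (B :: real^'n^'m)"
  unfolding transpose_def inner_vec_def by simp (rule sum.swap)

lemma inner_matrix_vector: "x \<bullet> (M *v y) = (transpose M *v x) \<bullet> (y :: real^'n)"
  by (metis dot_lmul_matrix transpose_matrix_vector)

definition outer :: "real^'m \<Rightarrow> real^'n \<Rightarrow> real^'n^'m" where
  "outer u v = (\<chi> i j. u $ i * v $ j)"

lemma inner_outer: "outer u v \<bullet> A = u \<bullet> (A *v v)"
  by (simp add: outer_def inner_vec_def matrix_vector_mult_def sum_distrib_left mult_ac)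

lemma transpose_outer: "transpose (outer u v) = outer v u"
  by (simp add: outer_def transpose_def vec_eq_iff)

lemma outer_mult: "outer u v ** M = outer u (transpose M *v v)"
  by (simp add: outer_def vec_eq_iff matrix_matrix_mult_def matrix_vector_mult_def transpose_def
      sum_distrib_left mult_ac)

lemma mult_outer: "M ** outer u v = outer (M *v u) v"
  by (simp add: outer_def vec_eq_iff matrix_matrix_mult_def matrix_vector_mult_def
      sum_distrib_right sum_distrib_left mult_ac)

lemma outer_mult_outer: "outer u v ** outer x y = (v \<bullet> x) *\<^sub>R outer u y"
  by (simp add: outer_def vec_eq_iff matrix_matrix_mult_def inner_vec_def sum_distrib_right sum_distrib_left mult_ac)

lemma outer_minus: "outer u (- v) = - outer u v"
  by (simp add: outer_def vec_eq_iff)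

lemma outer_zero [simp]: "outer u 0 = 0" "outer 0 v = 0"
  by (simp_all add: outer_def vec_eq_iff)

lemma symmetric_matrix_eq_0:
  fixes M :: "real^'n^'n"
  assumes "transpose M = M" and "\<And>v. v \<bullet> (M *v v) = 0"
  shows "M = 0"
proof -
  have "u \<bullet> (M *v v) = 0" for u v
  proof -
    have "u \<bullet> (M *v v) + v \<bullet> (M *v u) = 0"
      using assms(2)[of "u + v"] assms(2)[of u] assms(2)[of v]
      by (simp add: mv.add_right inner_add_left inner_add_right)
    moreover have "v \<bullet> (M *v u) = u \<bullet> (M *v v)"
      using inner_matrix_vector[of v M u] assms(1) by (simp add: inner_commute)
    ultimately show ?thesis by simp
  qed
  then have "M *v v = 0" for v by (metis inner_eq_zero_iff)
  then show ?thesis by (simp add: matrix_eq)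
qed

section \<open>Block matrices and the normal form in corank one\<close>

lemma sum_UNIV_option: "(\<Sum>i\<in>UNIV. f i) = f None + (\<Sum>i\<in>UNIV. f (Some (i::'m::finite)))"
  by (simp add: UNIV_option_conv sum.reindex)

lemma block_matrix_mult:
  "block_matrix A b c d ** block_matrix A' b' c' d' =
    block_matrix (A ** A' + outer b c') (A *v b' + d' *\<^sub>R b) (transpose A' *v c + d *\<^sub>R c')
      (c \<bullet> b' + d * d')"
  by (auto simp: vec_eq_iff block_matrix_def matrix_matrix_mult_def matrix_vector_mult_def
      transpose_def outer_def inner_vec_def sum_UNIV_option split: option.split)
    (simp_all add: mult_ac)

lemma block_matrix_eq_iff:
  "block_matrix A b c d = block_matrix A' b' c' d' \<longleftrightarrow> A = A' \<and> b = b' \<and> c = c' \<and> d = d'"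
  (is "?l = ?r")
proof
  assume l: ?l
  have "block_matrix A b c d $ i $ j = block_matrix A' b' c' d' $ i $ j" for i j
    using l by simp
  from this[of "Some _" "Some _"] this[of "Some _" None] this[of None "Some _"] this[of None None]
  show ?r by (simp add: block_matrix_def vec_eq_iff)
qed simp

lemma block_matrix_diff:
  "block_matrix A b c d - block_matrix A' b' c' d' = block_matrix (A - A') (b - b') (c - c') (d - d')"
  by (auto simp: vec_eq_iff block_matrix_def split: option.split)

lemma transpose_block_matrix:
  "transpose (block_matrix A b c d) = block_matrix (transpose A) c b d"
  by (auto simp: vec_eq_iff block_matrix_def transpose_def split: option.split)

lemma bounded_linear_jac_to_sym: "bounded_linear (jac_to_sym Nb)"
  unfolding linear_conv_bounded_linear[symmetric]
proof (rule linearI)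
  show "jac_to_sym Nb (x + y) = jac_to_sym Nb x + jac_to_sym Nb y" for x y
    by (cases x; cases y)
      (auto simp: vec_eq_iff block_matrix_def mm.add_right mv.add_right split: option.split)
  show "jac_to_sym Nb (r *\<^sub>R x) = r *\<^sub>R jac_to_sym Nb x" for r x
    by (cases x)
      (auto simp: vec_eq_iff block_matrix_def mm.scaleR_right mv.scaleR_right split: option.split)
qed

lemma matrix_inv_mult:
  assumes "invertible (A :: real^'n^'m)"
  shows "A ** matrix_inv A = mat 1" and "matrix_inv A ** A = mat 1"
  using someI_ex[of "\<lambda>A'. A ** A' = mat 1 \<and> A' ** A = mat 1"] assms
  by (auto simp: invertible_def matrix_inv_def)

lemma matrix_inv_eqI:
  fixes A :: "real^'n^'n"
  assumes "B ** A = mat 1"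
  shows "matrix_inv A = B"
proof -
  have AB: "A ** B = mat 1" using assms matrix_left_right_inverse by blast
  then have "invertible A" using assms by (auto simp: invertible_def)
  then have "B ** (A ** matrix_inv A) = B" by (simp add: matrix_inv_mult)
  then show ?thesis by (simp add: matrix_mul_assoc assms)
qed

declare transpose_matrix_vector [simp del]

text \<open>A unit kernel vector is made the last vector of an orthonormal basis. The last column of
  the transformed matrix then vanishes, and by antisymmetry so does the last row. The remaining
  block is invertible because its rank is at least that of \<open>N\<close>, which equals its
  size.\<close>

lemma skew_corank1_normal_form_exists:
  fixes N :: "real^('m::finite option)^('m option)"
  assumes "transpose N = - N" and rank: "rank N + 1 = CARD('m option)"
  shows "\<exists>Q Nb. corank1_normal_form N Q Nb"
proof -
  have "rank N \<noteq> CARD('m option)" using rank by simp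
  then obtain x where x: "x \<noteq> 0" "N *v x = 0"
    using matrix_nonfull_linear_equations_eq by blast
  define e where "e = x /\<^sub>R norm x"
  have e: "norm e = 1" "N *v e = 0" using x by (simp_all add: e_def mv.scaleR_right)
  obtain Q where Q: "orthogonal_matrix Q" "Q *v axis None 1 = e"
    using orthogonal_matrix_exists_basis[OF e(1)] by metis
  define M where "M = transpose Q ** N ** Q"
  have skew: "transpose M = - M"
    by (simp add: M_def matrix_transpose_mul assms(1) mm.minus_left mm.minus_right matrix_mul_assoc)
  have col: "M *v axis None 1 = 0"
    by (simp add: M_def matrix_vector_mul_assoc[symmetric] Q(2) e(2) mv.zero_right)
  have M1: "M $ i $ None = 0" for i
    using arg_cong[OF col, of "\<lambda>v. v $ i"] by (simp add: matrix_vector_mul_component inner_axis)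
  have sk: "M $ j $ i = - M $ i $ j" for i j
    using arg_cong[OF skew, of "\<lambda>A. A $ i $ j"] by (simp add: transpose_def)
  have M2: "M $ None $ j = 0" for j using sk[of None j] M1 by simp
  define Nb :: "real^'m^'m" where "Nb = (\<chi> i j. M $ Some i $ Some j)"
  have block: "M = block_matrix Nb 0 0 0"
    by (auto simp: vec_eq_iff block_matrix_def Nb_def M1 M2 split: option.split)
  have skb: "transpose Nb = - Nb"
    by (simp add: vec_eq_iff transpose_def Nb_def) (blast intro: sk)
  \<comment> \<open>The inclusion of the first coordinates; factoring \<open>M\<close> through it
    bounds \<open>rank M\<close> by \<open>rank Nb\<close>.\<close>
  define L :: "real^'m^('m option)" where "L = (\<chi> i j. if i = Some j then 1 else 0)"
  have "M = L ** Nb ** transpose L"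
    by (auto simp: block vec_eq_iff block_matrix_def L_def matrix_matrix_mult_def transpose_def
        if_distrib if_distribR sum.delta cong: if_cong split: option.split)
  then have "rank M \<le> rank Nb"
    using rank_mul_le_left[of "L ** Nb" "transpose L"] rank_mul_le_right[of L Nb] by simp
  moreover have "N = Q ** M ** transpose Q"
  proof -
    have "Q ** M ** transpose Q = (Q ** transpose Q) ** N ** (Q ** transpose Q)"
      by (simp add: M_def matrix_mul_assoc)
    then show ?thesis using Q(1) by (simp add: orthogonal_matrix_def)
  qed
  then have "rank N \<le> rank M"
    using rank_mul_le_left[of "Q ** M" "transpose Q"] rank_mul_le_right[of Q M] by simp
  moreover have "rank N = CARD('m)" using rank by simp
  moreover have "rank Nb \<le> CARD('m)" using rank_bound[of Nb] by simp
  ultimately have "inj ((*v) Nb)" by (simp add: full_rank_injective[symmetric])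
  then have "invertible Nb"
    by (simp add: invertible_left_inverse matrix_left_invertible_injective)
  then show ?thesis
    using Q block skb unfolding corank1_normal_form_def M_def by blast
qed

section \<open>The Jacobi group\<close>

locale symplectic_matrix =
  fixes Nb :: "real^'m::finite^'m"
  assumes skew: "transpose Nb = - Nb" and invertible: "invertible Nb"
begin

abbreviation "P \<equiv> matrix_inv Nb"
abbreviation "\<Omega> \<equiv> matrix_form (- P)"

lemma P_Nb: "P ** Nb = mat 1" and Nb_P: "Nb ** P = mat 1"
  by (simp_all add: matrix_inv_mult invertible)

lemma P_Nb_cancel: "P ** (Nb ** A) = A" "Nb ** (P ** A) = A"
    "A ** P ** Nb = A" "A ** Nb ** P = A"
    "P *v (Nb *v x) = x" "Nb *v (P *v x) = x"
  by (simp_all add: P_Nb Nb_P matrix_mul_assoc[symmetric] matrix_vector_mul_assoc)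
    (simp_all add: P_Nb Nb_P matrix_mul_assoc)

lemma transpose_P: "transpose P = - P"
proof -
  have "Nb ** transpose P = - mat 1"
    using arg_cong[OF P_Nb, of transpose]
    by (simp add: matrix_transpose_mul skew mm.minus_left transpose_mat minus_equation_iff)
  then have "P ** (Nb ** transpose P) = - P" by (simp add: mm.minus_right)
  then show ?thesis by (simp add: P_Nb_cancel)
qed

lemma Sp_iff: "g \<in> Sp \<Omega> \<longleftrightarrow> transpose g ** P ** g = P"
proof -
  have "g \<in> Sp \<Omega> \<longleftrightarrow> (\<forall>u v. u \<bullet> ((transpose g ** P ** g) *v v) = u \<bullet> (P *v v))"
    unfolding Sp_def matrix_form_def
    by (simp add: mv.minus_left matrix_vector_mul_assoc[symmetric] inner_matrix_vector[of _ "transpose g"])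
  also have "\<dots> \<longleftrightarrow> transpose g ** P ** g = P"
    by (metis matrix_eq vector_eq_ldot)
  finally show ?thesis .
qed

text \<open>Since \<open>P\<close> is antisymmetric, the two terms of the defining condition are, up
  to sign, the pairings with \<open>P ** A\<close> and with its transpose. This is what makes the
  block matrix X symmetric.\<close>

lemma sp_algebra_iff: "A \<in> sp_algebra \<Omega> \<longleftrightarrow> transpose (P ** A) = P ** A"
proof -
  have "\<Omega> (A *v u) v = u \<bullet> (transpose (P ** A) *v v)" for u v
    by (simp add: matrix_form_def matrix_transpose_mul transpose_P mm.minus_right mv.minus_left
        inner_matrix_vector[of u "transpose A"] matrix_vector_mul_assoc[symmetric] mv.minus_right)
  moreover have "\<Omega> u (A *v v) = - (u \<bullet> ((P ** A) *v v))" for u v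
    by (simp add: matrix_form_def mv.minus_left mm.minus_left matrix_vector_mul_assoc)
  ultimately have "A \<in> sp_algebra \<Omega> \<longleftrightarrow>
      (\<forall>u v. u \<bullet> (transpose (P ** A) *v v) = u \<bullet> ((P ** A) *v v))"
    by (simp add: sp_algebra_def)
  also have "\<dots> \<longleftrightarrow> transpose (P ** A) = P ** A"
    by (metis matrix_eq vector_eq_ldot)
  finally show ?thesis .
qed

text \<open>The adjoint with respect to \<Omega>. Multiplying g^T P g = P by \<open>Nb\<close> on
  the left shows that it inverts symplectic g; unlike \<open>matrix_inv\<close> it is linear in
  g.\<close>

definition adj :: "real^'m^'m \<Rightarrow> real^'m^'m" where
  "adj g = Nb ** transpose g ** P"

lemma adj_mult:
  assumes "g \<in> Sp \<Omega>"
  shows "adj g ** g = mat 1"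
  using assms unfolding Sp_iff adj_def by (metis Nb_P matrix_mul_assoc)

lemma mult_adj:
  assumes "g \<in> Sp \<Omega>"
  shows "g ** adj g = mat 1"
  using adj_mult[OF assms] matrix_left_right_inverse by blast

lemma \<Omega>_adj:
  assumes "g \<in> Sp \<Omega>"
  shows "\<Omega> (adj g *v x) (adj g *v y) = \<Omega> x y"
proof -
  have "\<Omega> (g *v (adj g *v x)) (g *v (adj g *v y)) = \<Omega> (adj g *v x) (adj g *v y)"
    using assms by (simp add: Sp_def)
  then show ?thesis by (simp add: matrix_vector_mul_assoc mult_adj[OF assms])
qed

lemma matrix_inv_Sp:
  assumes "g \<in> Sp \<Omega>"
  shows "matrix_inv g = adj g"
  by (rule matrix_inv_eqI[OF adj_mult[OF assms]])

text \<open>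
  The left Maurer--Cartan form, extended to all of the ambient space as a sum of a linear and a
  bilinear map. This is possible because \<open>adj\<close>, a linear map, is the inverse on the symplectic group.
\<close>

definition mc_lin :: "'m jac \<Rightarrow> 'm jac" where
  "mc_lin w = (0, 0, snd (snd w))"

definition mc_bil :: "'m jac \<Rightarrow> 'm jac \<Rightarrow> 'm jac" where
  "mc_bil p w = (adj (fst p) ** fst w, adj (fst p) *v fst (snd w), - \<Omega> (fst (snd p)) (fst (snd w)) / 2)"

definition mc :: "'m jac \<Rightarrow> 'm jac \<Rightarrow> 'm jac" where
  "mc p w = mc_lin w + mc_bil p w"

lemma bounded_linear_mc_lin: "bounded_linear mc_lin"
  unfolding mc_lin_def by (intro bounded_linear_intros)

lemma \<Omega>_bilinear: "\<Omega> (u + u') v = \<Omega> u v + \<Omega> u' v" "\<Omega> u (v + v') = \<Omega> u v + \<Omega> u v'"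
    "\<Omega> (r *\<^sub>R u) v = r * \<Omega> u v" "\<Omega> u (r *\<^sub>R v) = r * \<Omega> u v"
    "\<Omega> (- u) v = - \<Omega> u v" "\<Omega> u (- v) = - \<Omega> u v"
  by (simp_all add: matrix_form_def mv.add_right mv.scaleR_right mv.minus_right inner_add_left inner_add_right)

lemma adj_linear: "adj (g + g') = adj g + adj g'" "adj (r *\<^sub>R g) = r *\<^sub>R adj g"
  by (simp_all add: adj_def transpose_add transpose_scaleR mm.add_left mm.add_right mm.scaleR_left mm.scaleR_right)

lemma bounded_bilinear_mc_bil: "bounded_bilinear mc_bil"
  unfolding bilinear_conv_bounded_bilinear[symmetric] bilinear_def mc_bil_def
  by (auto intro!: linearI simp: \<Omega>_bilinear adj_linear mm.add_left mm.add_right mm.scaleR_left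
      mm.scaleR_right mv.add_left mv.add_right mv.scaleR_left mv.scaleR_right field_simps)

lemma bounded_linear_mc: "bounded_linear (mc p)"
  unfolding mc_def
  by (intro bounded_linear_add bounded_linear_mc_lin
      bounded_bilinear.bounded_linear_right[OF bounded_bilinear_mc_bil])

text \<open>Left translation by the inverse of p is an affine map of the ambient space whose linear
  part is \<open>mc p\<close>. The term with \<Omega> comes from the vector part -g^-1 u of the
  inverse, after the common factor g^-1 is removed by invariance.\<close>

lemma to_identity_eq:
  assumes "p \<in> Jac \<Omega>"
  shows "to_identity \<Omega> p w = mc p w"
proof -
  obtain g u a where p: "p = (g, u, a)" by (cases p)
  have g: "g \<in> Sp \<Omega>" using assms p by (simp add: Jac_def)
  note om = \<Omega>_adj[OF g]
  have "jac_mult \<Omega> (jac_inv p) = (\<lambda>q. (0, - (adj g *v u), - a) + mc p q)"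
  proof
    show "jac_mult \<Omega> (jac_inv p) q = (0, - (adj g *v u), - a) + mc p q" for q
      by (cases q) (simp add: p matrix_inv_Sp[OF g] mc_def mc_lin_def mc_bil_def \<Omega>_bilinear om)
  qed
  moreover have "((\<lambda>q. (0, - (adj g *v u), - a) + mc p q) has_derivative mc p) (at p)"
    using has_derivative_add[OF has_derivative_const bounded_linear_imp_has_derivative[OF bounded_linear_mc]]
    by simp
  ultimately have "frechet_derivative (jac_mult \<Omega> (jac_inv p)) (at p) = mc p"
    using frechet_derivative_at by metis
  then show ?thesis by (simp add: to_identity_def)
qed

fun jac_bracket :: "'m jac \<Rightarrow> 'm jac \<Rightarrow> 'm jac" where
  "jac_bracket (A, x, z) (B, y, w) = (A ** B - B ** A, A *v y - B *v x, \<Omega> x y)"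

text \<open>The linearisation of g^T P g = P; the other two components of the group are
  unconstrained.\<close>

definition tangent :: "'m jac \<Rightarrow> 'm jac \<Rightarrow> bool" where
  "tangent p w \<longleftrightarrow> transpose (fst w) ** P ** fst p + transpose (fst p) ** P ** fst w = 0"

lemma tangent_vector_derivative:
  assumes "open S" and "t \<in> S" and "\<And>t. t \<in> S \<Longrightarrow> c t \<in> Jac \<Omega>"
    and c: "(c has_vector_derivative w) (at t)"
  shows "tangent (c t) w"
proof -
  have f: "((\<lambda>t. fst (c t)) has_vector_derivative fst w) (at t)"
    by (rule bounded_linear.has_vector_derivative[OF bounded_linear_fst c])
  have tr: "((\<lambda>t. transpose (fst (c t))) has_vector_derivative transpose (fst w)) (at t)"
    using bounded_linear.has_vector_derivative[OF linear_transpose[unfolded linear_conv_bounded_linear] f] .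
  have "((\<lambda>t. transpose (fst (c t)) ** P ** fst (c t)) has_vector_derivative
      (transpose (fst (c t)) ** P ** fst w + (transpose (fst w) ** P) ** fst (c t))) (at t)"
    by (intro mm.has_vector_derivative f)
      (use mm.has_vector_derivative[OF tr has_vector_derivative_const[of P]] in \<open>simp add: mm.zero_right\<close>)
  moreover have "((\<lambda>t. transpose (fst (c t)) ** P ** fst (c t)) has_vector_derivative 0) (at t)"
  proof (rule has_vector_derivative_transform_within_open[OF has_vector_derivative_const assms(1,2)])
    show "P = transpose (fst (c t)) ** P ** fst (c t)" if "t \<in> S" for t
      using assms(3)[OF that] by (auto simp: Jac_def Sp_iff)
  qed
  ultimately show ?thesis
    unfolding tangent_def using vector_derivative_unique_at by (fastforce simp: add.commute)
qed

lemma mc_in_jac_algebra: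
  assumes "p \<in> Jac \<Omega>" and "tangent p w"
  shows "mc p w \<in> jac_algebra \<Omega>"
proof -
  let ?g = "fst p" and ?h = "fst w"
  have "P ** (adj ?g ** ?h) = transpose ?g ** P ** ?h"
    by (simp add: adj_def matrix_mul_assoc[symmetric] P_Nb_cancel)
  moreover have "transpose (transpose ?g ** P ** ?h) = - (transpose ?h ** P ** ?g)"
    by (simp add: matrix_transpose_mul transpose_P mm.minus_left mm.minus_right matrix_mul_assoc)
  ultimately have "adj ?g ** ?h \<in> sp_algebra \<Omega>"
    unfolding sp_algebra_iff using assms(2)
    by (simp add: tangent_def add_eq_0_iff)
  then show ?thesis
    by (simp add: mc_def mc_lin_def mc_bil_def jac_algebra_def)
qed

text \<open>The left side does not mention p. The base point enters because a tangent vector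
  satisfies an equation at p, which allows \<open>adj w\<close> to be rewritten through g^-1 and the
  left translate of w.\<close>

lemma maurer_cartan:
  assumes "p \<in> Jac \<Omega>" and "tangent p w" and "tangent p w'"
  shows "mc_bil w' w - mc_bil w w' = jac_bracket (mc p w) (mc p w')"
proof -
  obtain g u a where p: "p = (g, u, a)" by (cases p)
  obtain h v b where w: "w = (h, v, b)" by (cases w)
  obtain h' v' b' where w': "w' = (h', v', b')" by (cases w')
  have g: "g \<in> Sp \<Omega>" using assms p by (simp add: Jac_def)
  note gadj = mult_adj[OF g]
  \<comment> \<open>On tangent vectors \<open>adj\<close> agrees with the derivative of inversion, k
    |-> -g^-1 k g^-1. The assumption is the tangency equation, solved for k^T P.\<close>
  have key: "adj k = - (adj g ** k) ** adj g" if "transpose k ** P ** g + transpose g ** P ** k = 0" for k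
  proof -
    have "transpose k ** P = - (transpose g ** P ** k) ** adj g"
    proof -
      have "transpose k ** P ** g = - (transpose g ** P ** k)"
        using that by (simp add: eq_neg_iff_add_eq_0)
      then have "transpose k ** P ** g ** adj g = - (transpose g ** P ** k) ** adj g" by simp
      then show ?thesis by (simp add: matrix_mul_assoc[symmetric] gadj)
    qed
    then have "Nb ** (transpose k ** P) = Nb ** (- (transpose g ** P ** k) ** adj g)" by simp
    then show ?thesis by (simp add: adj_def matrix_mul_assoc mm.minus_left mm.minus_right)
  qed
  have k: "adj h = - (adj g ** h) ** adj g" "adj h' = - (adj g ** h') ** adj g"
    using assms p w w' by (auto intro!: key simp: tangent_def)
  note om = \<Omega>_adj[OF g]
  \<comment> \<open>By antisymmetry the two terms with factor 1/2 add up to one full \<Omega>, the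
    central component of the bracket.\<close>
  have sk: "\<Omega> v' v = - \<Omega> v v'"
    by (simp add: matrix_form_def inner_matrix_vector[of v'] transpose_P mv.minus_left transpose_minus inner_commute)
  show ?thesis
    by (simp add: p w w' mc_def mc_lin_def mc_bil_def k om sk mm.minus_left mv.minus_left
        matrix_mul_assoc matrix_vector_mul_assoc)
qed

subsection \<open>The kinetic energy\<close>

lemma kinetic_eq:
  "kinetic Nb (A, x, z) = ((P ** A) \<bullet> (P ** A)) / 2 + (P *v x) \<bullet> (P *v x) + 2 * z\<^sup>2"
proof -
  have "transpose A ** - (P ** P) ** A = transpose (P ** A) ** (P ** A)"
    by (simp add: matrix_transpose_mul transpose_P mm.minus_left mm.minus_right matrix_mul_assoc)
  moreover have "x \<bullet> (- (P ** P) *v x) = (P *v x) \<bullet> (P *v x)"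
    by (simp add: inner_matrix_vector[of "P *v x"] transpose_P mv.minus_left mm.minus_left matrix_vector_mul_assoc
        inner_commute)
  ultimately show ?thesis
    by (simp add: Let_def trace_transpose_mult)
qed

text \<open>The right side is the entrywise inner product of the two block matrices: the
  off-diagonal block occurs twice, and the corner entries are 2z and 2w.\<close>

lemma polar_kinetic:
  "polar (kinetic Nb) (A, x, z) (B, y, w) =
    (P ** A) \<bullet> (P ** B) + 2 * ((P *v x) \<bullet> (P *v y)) + 4 * z * w"
  by (simp add: polar_def kinetic_eq mm.add_right mv.add_right inner_add_left inner_add_right
      inner_commute[of "P ** B" "P ** A"] inner_commute[of "P *v y" "P *v x"] power2_eq_square field_simps
      del: kinetic.simps)

lemma polar_kinetic_commute: "polar (kinetic Nb) \<xi> \<eta> = polar (kinetic Nb) \<eta> \<xi>"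
  by (simp add: polar_def add.commute)

lemma bounded_bilinear_polar_kinetic: "bounded_bilinear (polar (kinetic Nb))"
  unfolding bilinear_conv_bounded_bilinear[symmetric] bilinear_def
proof (intro conjI allI)
  show lin: "linear (polar (kinetic Nb) \<xi>)" for \<xi>
  proof (rule linearI)
    show "polar (kinetic Nb) \<xi> (x + y) = polar (kinetic Nb) \<xi> x + polar (kinetic Nb) \<xi> y" for x y
      by (cases \<xi>; cases x; cases y)
        (simp add: polar_kinetic mm.add_right mv.add_right inner_add_right algebra_simps)
    show "polar (kinetic Nb) \<xi> (r *\<^sub>R x) = r *\<^sub>R polar (kinetic Nb) \<xi> x" for r x
      by (cases \<xi>; cases x)
        (simp add: polar_kinetic mm.scaleR_right mv.scaleR_right algebra_simps)
  qed
  show "linear (\<lambda>\<xi>. polar (kinetic Nb) \<xi> \<eta>)" for \<eta>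
    using lin[of \<eta>] by (simp add: polar_kinetic_commute[of _ \<eta>])
qed

text \<open>
  The integrand of the first variation of the energy, \<open>\<xi>'\<close> being the time derivative of \<open>\<xi>\<close>: its
  vanishing for all \<open>\<eta>\<close> is the Euler--Poincare equation.
\<close>

definition euler_poincare :: "'m jac \<Rightarrow> 'm jac \<Rightarrow> 'm jac \<Rightarrow> real" where
  "euler_poincare \<xi> \<xi>' \<eta> = polar (kinetic Nb) \<xi> (jac_bracket \<xi> \<eta>) - polar (kinetic Nb) \<xi>' \<eta>"

text \<open>Transposition rules move every factor off B and y until only R = P B and r = P y remain.
  Their cofactors, with the corner 2z', are the blocks of X' - [X^2, N0], so the right side is minus
  an inner product of block matrices.\<close>

lemma euler_poincare_eq:
  fixes A A' B :: "real^'m^'m" and x x' y :: "real^'m" and z z' w :: real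
  assumes "A \<in> sp_algebra \<Omega>" and "B \<in> sp_algebra \<Omega>"
  defines "S \<equiv> P ** A" and "s \<equiv> P *v x"
  shows "euler_poincare (A, x, z) (A', x', z') (B, y, w) =
    - ((P ** A' - commutator (S ** S + outer s s) Nb) \<bullet> (P ** B) +
       2 * ((P *v x' + Nb *v (S *v s + (2 * z) *\<^sub>R s)) \<bullet> (P *v y)) + 4 * z' * w)"
proof -
  define R where "R = P ** B"
  define r where "r = P *v y"
  have S: "transpose S = S" and R: "transpose R = R"
    using assms(1,2) by (simp_all add: S_def R_def sp_algebra_iff)
  have AB: "A = Nb ** S" "B = Nb ** R" "x = Nb *v s" "y = Nb *v r"
    by (simp_all add: S_def R_def s_def r_def P_Nb_cancel)
  have 1: "S \<bullet> (P ** (A ** B - B ** A)) = commutator (S ** S) Nb \<bullet> R"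
  proof -
    have "S \<bullet> (P ** (A ** B - B ** A)) = S \<bullet> (S ** (Nb ** R)) - S \<bullet> (R ** (Nb ** S))"
      by (simp add: AB mm.diff_right inner_diff_right matrix_mul_assoc[symmetric] P_Nb_cancel)
    also have "S \<bullet> (S ** (Nb ** R)) = - ((Nb ** (S ** S)) \<bullet> R)"
      by (simp add: inner_mult_left[of S S "Nb ** R"] inner_mult_left[of "S ** S" Nb R] S skew mm.minus_left)
    also have "S \<bullet> (R ** (Nb ** S)) = - ((S ** S ** Nb) \<bullet> R)"
      unfolding inner_mult_right[of S R "Nb ** S"]
      by (simp add: S skew matrix_transpose_mul mm.minus_right matrix_mul_assoc)
    also have "- ((Nb ** (S ** S)) \<bullet> R) - - ((S ** S ** Nb) \<bullet> R) = commutator (S ** S) Nb \<bullet> R"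
      by (simp add: commutator_def inner_diff_left)
    finally show ?thesis .
  qed
  have 2: "2 * (s \<bullet> (P *v (A *v y - B *v x))) =
      - 2 * ((Nb *v (S *v s)) \<bullet> r) + commutator (outer s s) Nb \<bullet> R"
  proof -
    have "s \<bullet> (P *v (A *v y - B *v x)) = s \<bullet> (S *v (Nb *v r)) - s \<bullet> (R *v (Nb *v s))"
      by (simp add: AB mv.diff_right inner_diff_right matrix_vector_mul_assoc matrix_mul_assoc P_Nb)
    moreover have "s \<bullet> (S *v (Nb *v r)) = - ((Nb *v (S *v s)) \<bullet> r)"
      by (simp add: inner_matrix_vector[of s S] inner_matrix_vector[of _ Nb] S skew mv.minus_left)
    moreover have "s \<bullet> (R *v (Nb *v s)) = - ((outer s s ** Nb) \<bullet> R)"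
      by (simp add: outer_mult skew mv.minus_left outer_minus inner_outer)
    \<comment> \<open>Symmetry of R lets half of the doubled term be replaced by its transpose,
      which completes the commutator; the weight 2 on the vector part is exactly what this
      requires.\<close>
    moreover have "(outer s s ** Nb) \<bullet> R = - ((Nb ** outer s s) \<bullet> R)"
      using inner_transpose[of "outer s s ** Nb" R]
      by (simp add: R matrix_transpose_mul skew transpose_outer mm.minus_left)
    ultimately show ?thesis
      by (simp add: commutator_def inner_diff_left)
  qed
  have 3: "\<Omega> x y = - ((Nb *v s) \<bullet> r)"
    by (simp add: AB matrix_form_def mv.minus_left P_Nb_cancel)
  have com: "commutator (S ** S + outer s s) Nb = commutator (S ** S) Nb + commutator (outer s s) Nb"
    by (simp add: commutator_def mm.add_left mm.add_right)
  show ?thesis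
    unfolding euler_poincare_def jac_bracket.simps polar_kinetic
      S_def[symmetric] s_def[symmetric] R_def[symmetric] r_def[symmetric] com
    using 1 2 3
    by (simp add: inner_add_left inner_diff_left mv.add_right mv.scaleR_right algebra_simps)
qed

text \<open>This is the map x |-> \<Omega>(Nb v, x) Nb v. The factor \<open>Nb\<close> is chosen so
  that \<open>P\<close> turns it into v v^T, whose pairing with M is the value of the quadratic form
  of M at v.\<close>

definition transvection_generator :: "real^'m \<Rightarrow> real^'m^'m" where
  "transvection_generator v = Nb ** outer v v"

lemma P_transvection_generator: "P ** transvection_generator v = outer v v"
  by (simp add: transvection_generator_def P_Nb_cancel)

lemma transvection_generator_in_sp: "transvection_generator v \<in> sp_algebra \<Omega>"
  by (simp add: sp_algebra_iff P_transvection_generator transpose_outer)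

text \<open>Only the upper left block of N0 is nonzero, so the corner of the commutator vanishes and
  z is conserved. Its off-diagonal blocks agree because \<open>P ** A\<close> is symmetric and
  \<open>Nb\<close> antisymmetric, hence three conditions instead of four.\<close>

lemma jac_to_sym_eq_commutator_iff:
  "jac_to_sym Nb (A', x', z') =
     commutator (jac_to_sym Nb (A, x, z) ** jac_to_sym Nb (A, x, z)) (block_matrix Nb 0 0 0) \<longleftrightarrow>
   P ** A' - commutator (P ** A ** (P ** A) + outer (P *v x) (P *v x)) Nb = 0 \<and>
   P *v x' + Nb *v ((P ** A) *v (P *v x) + (2 * z) *\<^sub>R (P *v x)) = 0 \<and> z' = 0"
  if "A \<in> sp_algebra \<Omega>"
  using that
  by (auto simp: commutator_def block_matrix_mult block_matrix_diff block_matrix_eq_iff sp_algebra_iff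
      skew mv.minus_left mv.zero_right mm.zero_right add_eq_0_iff outer_zero)

text \<open>Both claims come from a cycle: the matrix equation gives vanishing for all \<eta>, in
  particular for the test vectors, and these give back the matrix equation. The second claim is
  stated separately because only the test vectors are realised by explicit variations.\<close>

lemma euler_poincare_iff:
  assumes "\<xi> \<in> jac_algebra \<Omega>" and "\<xi>' \<in> jac_algebra \<Omega>"
  shows "jac_to_sym Nb \<xi>' =
      commutator (jac_to_sym Nb \<xi> ** jac_to_sym Nb \<xi>) (block_matrix Nb 0 0 0) \<longleftrightarrow>
    (\<forall>\<eta>\<in>jac_algebra \<Omega>. euler_poincare \<xi> \<xi>' \<eta> = 0)" (is "?bi \<longleftrightarrow> ?ep")
    and "(\<And>v y w. euler_poincare \<xi> \<xi>' (transvection_generator v, y, w) = 0) \<Longrightarrow> 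
      (\<forall>\<eta>\<in>jac_algebra \<Omega>. euler_poincare \<xi> \<xi>' \<eta> = 0)" (is "PROP ?tv \<Longrightarrow> _")
proof -
  obtain A x z where \<xi>: "\<xi> = (A, x, z)" by (cases \<xi>)
  obtain A' x' z' where \<xi>': "\<xi>' = (A', x', z')" by (cases \<xi>')
  have A: "A \<in> sp_algebra \<Omega>" "A' \<in> sp_algebra \<Omega>"
    using assms by (simp_all add: \<xi> \<xi>' jac_algebra_def)
  let ?M = "P ** A' - commutator (P ** A ** (P ** A) + outer (P *v x) (P *v x)) Nb"
  let ?m = "P *v x' + Nb *v ((P ** A) *v (P *v x) + (2 * z) *\<^sub>R (P *v x))"
  note bi = jac_to_sym_eq_commutator_iff[OF A(1), of A' x' z' x z, folded \<xi> \<xi>']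
  have bi_ep: "?bi \<Longrightarrow> ?ep"
    using bi euler_poincare_eq[OF A(1)] by (auto simp: \<xi> \<xi>' jac_algebra_def)
  have tv_bi: "PROP ?tv \<Longrightarrow> ?bi"
  proof -
    assume tv: "PROP ?tv"
    have E: "?M \<bullet> outer v v + 2 * (?m \<bullet> (P *v y)) + 4 * z' * w = 0" for v y w
      using tv[of v y w] euler_poincare_eq[OF A(1) transvection_generator_in_sp[of v], of x z A' x' z' y w]
      unfolding \<xi> \<xi>' by (simp add: P_transvection_generator)
    \<comment> \<open>The commutator of a symmetric and an antisymmetric matrix is symmetric;
      without this the values of the quadratic form would not determine \<open>?M\<close>.\<close>
    have "transpose ?M = ?M"
      using A by (simp add: sp_algebra_iff transpose_diff transpose_add commutator_def matrix_transpose_mul[of Nb]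
          matrix_transpose_mul[of "_ + _"] matrix_transpose_mul[of "P ** A"] transpose_outer skew mm.minus_left mm.minus_right)
    moreover have "v \<bullet> (?M *v v) = 0" for v
      using E[of v 0 0] by (simp add: inner_outer[symmetric] inner_commute mv.zero_right)
    ultimately have "?M = 0" by (rule symmetric_matrix_eq_0)
    moreover have "z' = 0" using E[of 0 0 1] \<open>?M = 0\<close> by (simp add: mv.zero_right)
    \<comment> \<open>The choice \<open>y = Nb *v ?m\<close> makes \<open>P *v y\<close> equal to
      \<open>?m\<close>.\<close>
    moreover have "?m \<bullet> ?m = 0"
      using E[of 0 "Nb *v ?m" 0] \<open>?M = 0\<close> by (simp add: P_Nb_cancel)
    ultimately show ?bi using bi by simp
  qed
  show "?bi \<longleftrightarrow> ?ep"
  proof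
    assume ep: ?ep
    show ?bi
      by (rule tv_bi) (use ep transvection_generator_in_sp in \<open>simp add: jac_algebra_def\<close>)
  qed (rule bi_ep)
  show "PROP ?tv \<Longrightarrow> ?ep" using tv_bi bi_ep by blast
qed

subsection \<open>Geodesics\<close>

lemma smooth_on_mc:
  "open S \<Longrightarrow> smooth_on f S \<Longrightarrow> smooth_on g S \<Longrightarrow> smooth_on (\<lambda>x. mc (f x) (g x)) S"
  unfolding mc_def
  by (intro smooth_on_add smooth_on_bounded_linear[OF bounded_linear_mc_lin]
      smooth_on_bounded_bilinear[OF bounded_bilinear_mc_bil])

text \<open>Inside the group the metric is \<open>polar (kinetic Nb)\<close> of \<open>mc\<close>,
  so the ambient first variation formula applies with \<open>mc_lin\<close> and
  \<open>mc_bil\<close>. The Maurer--Cartan identity then turns the antisymmetrised part into the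
  bracket.\<close>

lemma energy_has_derivative:
  assumes T: "open T" "is_interval T" and \<gamma>: "smooth_curve_in (Jac \<Omega>) T \<gamma>"
    and \<Gamma>: "proper_variation (Jac \<Omega>) T \<gamma> a b \<epsilon> \<Gamma>" and "\<epsilon> > 0" and ab: "a < b" "{a..b} \<subseteq> T"
    and \<xi>': "\<And>t. t \<in> T \<Longrightarrow>
      ((\<lambda>t. mc (\<gamma> t) (vector_derivative \<gamma> (at t))) has_vector_derivative \<xi>' t) (at t)"
  defines "\<eta> \<equiv> \<lambda>t. mc (\<gamma> t) (vector_derivative (\<lambda>s. \<Gamma> s t) (at 0))"
  shows "((\<lambda>s. energy (left_invariant_metric \<Omega> (kinetic Nb)) a b (\<Gamma> s)) has_real_derivative
      integral {a..b} (\<lambda>t. euler_poincare (mc (\<gamma> t) (vector_derivative \<gamma> (at t))) (\<xi>' t) (\<eta> t))) (at 0)"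
    and "\<And>t. t \<in> T \<Longrightarrow> \<eta> t \<in> jac_algebra \<Omega>"
proof -
  define F where "F = (\<lambda>(s, t). \<Gamma> s t)"
  let ?I = "{-\<epsilon><..<\<epsilon>}" and ?S = "{-\<epsilon><..<\<epsilon>} \<times> T"
  define D where "D = (\<lambda>v (f :: real \<times> real \<Rightarrow> 'm jac) x. frechet_derivative f (at x) v)"
  have F: "smooth_on F ?S" and FJ: "\<And>s t. s \<in> ?I \<Longrightarrow> t \<in> T \<Longrightarrow> F (s, t) \<in> Jac \<Omega>"
    and F0: "\<And>t. t \<in> T \<Longrightarrow> F (0, t) = \<gamma> t"
    and Fab: "\<And>s. s \<in> ?I \<Longrightarrow> F (s, a) = \<gamma> a" "\<And>s. s \<in> ?I \<Longrightarrow> F (s, b) = \<gamma> b"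
    using \<Gamma> by (auto simp: proper_variation_def F_def)
  have zero: "0 \<in> ?I" using \<open>\<epsilon> > 0\<close> by simp
  have p1: "((\<lambda>s. F (s, t)) has_vector_derivative D (1, 0) F (s, t)) (at s)"
    and p2: "((\<lambda>t. F (s, t)) has_vector_derivative D (0, 1) F (s, t)) (at t)"
    if "s \<in> ?I" "t \<in> T" for s t
    unfolding D_def using that
    by (auto intro: smooth_on_partial_fst[OF F] smooth_on_partial_snd[OF F])
  have vd1: "vector_derivative (\<lambda>s. \<Gamma> s t) (at 0) = D (1, 0) F (0, t)" if "t \<in> T" for t
    using vector_derivative_at[OF p1[OF zero that]] by (simp add: F_def)
  have vd2: "vector_derivative (\<Gamma> s) (at t) = D (0, 1) F (s, t)" if "s \<in> ?I" "t \<in> T" for s t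
    using vector_derivative_at[OF p2[OF that]] by (simp add: F_def)
  have vd0: "vector_derivative \<gamma> (at t) = D (0, 1) F (0, t)" if "t \<in> T" for t
    by (rule vector_derivative_at[OF has_vector_derivative_transform_within_open[OF p2[OF zero that] T(1) that F0]])
  have tan1: "tangent (F (0, t)) (D (1, 0) F (0, t))" if "t \<in> T" for t
    by (rule tangent_vector_derivative[OF _ zero _ p1[OF zero that]]) (use FJ that in auto)
  have tan2: "tangent (F (0, t)) (D (0, 1) F (0, t))" if "t \<in> T" for t
    by (rule tangent_vector_derivative[OF T(1) that _ p2[OF zero that]]) (use FJ zero in auto)
  have \<eta>: "\<eta> t = mc (F (0, t)) (D (1, 0) F (0, t))" if "t \<in> T" for t
    using that by (simp add: \<eta>_def vd1 F0)
  show "\<eta> t \<in> jac_algebra \<Omega>" if "t \<in> T" for t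
    unfolding \<eta>[OF that] by (rule mc_in_jac_algebra[OF FJ[OF zero that] tan1[OF that]])
  \<comment> \<open>Fixed end points make the map constant in s there, so \<eta> vanishes at a and
    b, as the integration by parts demands.\<close>
  have end0: "D (1, 0) F (0, t) = 0" if "t \<in> T" "\<And>s. s \<in> ?I \<Longrightarrow> F (s, t) = \<gamma> t" for t
  proof (rule vector_derivative_unique_at[OF p1[OF zero that(1)]])
    show "((\<lambda>s. F (s, t)) has_vector_derivative 0) (at 0)"
      by (rule has_vector_derivative_transform_within_open[OF has_vector_derivative_const _ zero])
        (use that(2) in auto)
  qed
  have abT: "a \<in> T" "b \<in> T" using ab by auto
  note mc0 = linear_0[OF bounded_linear.linear[OF bounded_linear_mc]]
  have \<xi>'F: "((\<lambda>t. mc (F (0, t)) (D (0, 1) F (0, t))) has_vector_derivative \<xi>' t) (at t)" if "t \<in> T" for t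
    by (rule has_vector_derivative_transform_within_open[OF \<xi>'[OF that] T(1) that])
      (simp add: vd0 F0)
  have "((\<lambda>s. integral {a..b} (\<lambda>t. polar (kinetic Nb) (mc (F (s, t)) (D (0, 1) F (s, t)))
        (mc (F (s, t)) (D (0, 1) F (s, t))) / 2)) has_real_derivative
      integral {a..b} (\<lambda>t. polar (kinetic Nb) (mc (F (0, t)) (D (0, 1) F (0, t)))
        (mc_bil (D (1, 0) F (0, t)) (D (0, 1) F (0, t)) - mc_bil (D (0, 1) F (0, t)) (D (1, 0) F (0, t))) -
        polar (kinetic Nb) (\<xi>' t) (mc (F (0, t)) (D (1, 0) F (0, t))))) (at 0)"
    using first_variation_integral[OF F \<open>\<epsilon> > 0\<close> T ab bounded_linear_mc_lin bounded_bilinear_mc_bil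
        bounded_bilinear_polar_kinetic polar_kinetic_commute, folded mc_def, of \<xi>']
      end0[OF abT(1) Fab(1)] end0[OF abT(2) Fab(2)] \<xi>'F mc0
    by (simp add: D_def)
  moreover have "integral {a..b} (\<lambda>t. polar (kinetic Nb) (mc (F (0, t)) (D (0, 1) F (0, t)))
        (mc_bil (D (1, 0) F (0, t)) (D (0, 1) F (0, t)) - mc_bil (D (0, 1) F (0, t)) (D (1, 0) F (0, t))) -
        polar (kinetic Nb) (\<xi>' t) (mc (F (0, t)) (D (1, 0) F (0, t)))) =
      integral {a..b} (\<lambda>t. euler_poincare (mc (\<gamma> t) (vector_derivative \<gamma> (at t))) (\<xi>' t) (\<eta> t))"
  proof (rule integral_cong)
    fix t assume "t \<in> {a..b}"
    then have t: "t \<in> T" using ab by auto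
    show "polar (kinetic Nb) (mc (F (0, t)) (D (0, 1) F (0, t)))
        (mc_bil (D (1, 0) F (0, t)) (D (0, 1) F (0, t)) - mc_bil (D (0, 1) F (0, t)) (D (1, 0) F (0, t))) -
        polar (kinetic Nb) (\<xi>' t) (mc (F (0, t)) (D (1, 0) F (0, t))) =
      euler_poincare (mc (\<gamma> t) (vector_derivative \<gamma> (at t))) (\<xi>' t) (\<eta> t)"
      unfolding maurer_cartan[OF FJ[OF zero t] tan2[OF t] tan1[OF t]] euler_poincare_def
        vd0[OF t] \<eta>[OF t] F0[OF t] ..
  qed
  moreover have "integral {a..b} (\<lambda>t. polar (kinetic Nb) (mc (F (s, t)) (D (0, 1) F (s, t)))
        (mc (F (s, t)) (D (0, 1) F (s, t))) / 2) = energy (left_invariant_metric \<Omega> (kinetic Nb)) a b (\<Gamma> s)"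
    if s: "s \<in> ?I" for s
    unfolding energy_def
  proof (rule integral_cong)
    fix t assume "t \<in> {a..b}"
    then have t: "t \<in> T" using ab by auto
    have "\<Gamma> s t \<in> Jac \<Omega>" using FJ[OF s t] by (simp add: F_def)
    then show "polar (kinetic Nb) (mc (F (s, t)) (D (0, 1) F (s, t))) (mc (F (s, t)) (D (0, 1) F (s, t))) / 2 =
      left_invariant_metric \<Omega> (kinetic Nb) (\<Gamma> s t) (vector_derivative (\<Gamma> s) (at t))
        (vector_derivative (\<Gamma> s) (at t)) / 2"
      by (simp add: left_invariant_metric_def to_identity_eq vd2[OF s t]) (simp add: F_def)
  qed
  ultimately show "((\<lambda>s. energy (left_invariant_metric \<Omega> (kinetic Nb)) a b (\<Gamma> s)) has_real_derivative
      integral {a..b} (\<lambda>t. euler_poincare (mc (\<gamma> t) (vector_derivative \<gamma> (at t))) (\<xi>' t) (\<eta> t))) (at 0)"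
    using has_field_derivative_transform_within_open[OF _ open_greaterThanLessThan zero] by fastforce
qed

section \<open>Symplectic transvections and affine variations\<close>

lemma transvection_in_Sp: "mat 1 + r *\<^sub>R transvection_generator v \<in> Sp \<Omega>"
proof -
  let ?B = "transvection_generator v"
  \<comment> \<open>This scalar is the coefficient in \<open>?B ** ?B\<close>. In the expansion of
    the symplectic condition it removes the quadratic term in r, while the linear terms cancel by
    \<open>tB\<close>.\<close>
  have "v \<bullet> (Nb *v v) = 0"
    using inner_matrix_vector[of v Nb v] by (simp add: skew mv.minus_left inner_commute)
  then have BB: "?B ** ?B = 0"
    unfolding transvection_generator_def mult_outer[of Nb] by (simp add: outer_mult_outer)
  have tB: "transpose ?B ** P = - (P ** ?B)"
    using transvection_generator_in_sp[of v]
    by (simp add: sp_algebra_iff matrix_transpose_mul transpose_P mm.minus_right minus_equation_iff eq_commute)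
  have "P ** ?B ** ?B = 0"
    by (simp add: matrix_mul_assoc[symmetric] BB mm.zero_right)
  then show ?thesis
    by (simp add: Sp_iff transpose_add transpose_scaleR transpose_mat mm.add_left mm.add_right
        mm.diff_left mm.scaleR_left mm.scaleR_right tB)
qed

lemma Jac_mult:
  assumes "p \<in> Jac \<Omega>" and "q \<in> Jac \<Omega>"
  shows "jac_mult \<Omega> p q \<in> Jac \<Omega>"
  using assms by (cases p; cases q) (auto simp: Jac_def Sp_def matrix_vector_mul_assoc[symmetric])

text \<open>
  The velocity of the affine curve \<open>r \<mapsto> p (1 + r B, r y, r w)\<close>. It stays in the Jacobi group if \<open>B\<close> is
  a transvection generator, because then \<open>B\<close> has square zero.
\<close>

definition affine_velocity :: "real^'m^'m \<Rightarrow> real^'m \<Rightarrow> real \<Rightarrow> 'm jac \<Rightarrow> 'm jac" where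
  "affine_velocity B y w p =
    (fst p ** B, fst p *v y, w + \<Omega> (fst (snd p)) (fst p *v y) / 2)"

lemma jac_mult_affine:
  "jac_mult \<Omega> p (mat 1 + r *\<^sub>R B, r *\<^sub>R y, r * w) = p + r *\<^sub>R affine_velocity B y w p"
  by (cases p) (simp add: affine_velocity_def mm.add_right mm.scaleR_right mv.scaleR_right \<Omega>_bilinear algebra_simps)

text \<open>The velocity is the left translate of (B, y, w) to p; its half \<Omega> cancels the one
  in \<open>mc_bil\<close>. Hence the test vector of the variation does not depend on the
  curve.\<close>

lemma mc_affine_velocity:
  assumes "p \<in> Jac \<Omega>"
  shows "mc p (affine_velocity B y w p) = (B, y, w)"
proof -
  have "adj (fst p) ** fst p = mat 1" using assms adj_mult by (auto simp: Jac_def)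
  then show ?thesis
    by (simp add: mc_def mc_lin_def mc_bil_def affine_velocity_def matrix_mul_assoc matrix_vector_mul_assoc)
qed

lemma smooth_on_affine_velocity:
  assumes "open S" and f: "smooth_on f S"
  shows "smooth_on (\<lambda>x. affine_velocity B y w (f x)) S"
proof -
  have 1: "smooth_on (\<lambda>x. fst (f x)) S" "smooth_on (\<lambda>x. fst (snd (f x))) S"
    using smooth_on_bounded_linear[OF bounded_linear_fst assms]
      smooth_on_bounded_linear[OF bounded_linear_fst assms(1)
        smooth_on_bounded_linear[OF bounded_linear_snd assms]] by auto
  have gy: "smooth_on (\<lambda>x. fst (f x) *v y) S"
    by (rule smooth_on_bounded_linear[OF mv.bounded_linear_left assms(1) 1(1)])
  have "bounded_bilinear (\<lambda>u v. \<Omega> u v / 2)"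
    unfolding bilinear_conv_bounded_bilinear[symmetric] bilinear_def
    by (auto intro!: linearI simp: \<Omega>_bilinear add_divide_distrib)
  then have "smooth_on (\<lambda>x. \<Omega> (fst (snd (f x))) (fst (f x) *v y) / 2) S"
    by (rule smooth_on_bounded_bilinear[OF _ assms(1) 1(2) gy])
  then show ?thesis
    unfolding affine_velocity_def
    by (intro smooth_on_Pair smooth_on_add smooth_on_const gy assms
        smooth_on_bounded_linear[OF mm.bounded_linear_left assms(1) 1(1)])
qed

text \<open>The group parameter r is taken as s (t - a) (b - t), which vanishes at both ends and
  makes \<eta> equal to the weight times a constant vector.\<close>

definition affine_variation ::
  "(real \<Rightarrow> 'm jac) \<Rightarrow> real \<Rightarrow> real \<Rightarrow> real^'m^'m \<Rightarrow> real^'m \<Rightarrow> real \<Rightarrow> real \<Rightarrow> real \<Rightarrow> 'm jac" where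
  "affine_variation \<gamma> a b B y w s t =
    \<gamma> t + (s * ((t - a) * (b - t))) *\<^sub>R affine_velocity B y w (\<gamma> t)"

lemma proper_affine_variation:
  assumes "open T" and \<gamma>: "smooth_curve_in (Jac \<Omega>) T \<gamma>"
  shows "proper_variation (Jac \<Omega>) T \<gamma> a b \<epsilon> (affine_variation \<gamma> a b (transvection_generator v) y w)"
proof -
  let ?B = "transvection_generator v" and ?S = "{-\<epsilon><..<\<epsilon>} \<times> T"
  have S: "open ?S" using assms(1) by (intro open_Times) auto
  have \<gamma>s: "smooth_on (\<lambda>x. \<gamma> (snd x)) ?S"
    using \<gamma> assms(1) by (intro smooth_on_comp_snd) (auto simp: smooth_curve_in_def)
  have sn: "smooth_on (snd :: real \<times> real \<Rightarrow> real) ?S" and fs: "smooth_on (fst :: real \<times> real \<Rightarrow> real) ?S"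
    by (intro smooth_on_linear S bounded_linear_snd bounded_linear_fst)+
  have sn': "smooth_on (\<lambda>x :: real \<times> real. snd x + - a) ?S" "smooth_on (\<lambda>x :: real \<times> real. b + - snd x) ?S"
    by (intro smooth_on_add smooth_on_const S sn
        smooth_on_bounded_linear[OF bounded_linear_minus[OF bounded_linear_ident]])+
  have "smooth_on (\<lambda>x :: real \<times> real. fst x * ((snd x + - a) * (b + - snd x))) ?S"
    by (intro smooth_on_bounded_bilinear[OF bounded_bilinear_mult] S fs sn')
  from smooth_on_add[OF S \<gamma>s smooth_on_bounded_bilinear[OF bounded_bilinear_scaleR S this
        smooth_on_affine_velocity[OF S \<gamma>s, of ?B y w]]]
  have "smooth_on (\<lambda>(s, t). affine_variation \<gamma> a b ?B y w s t) ?S"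
    unfolding affine_variation_def split_beta by simp
  moreover have "affine_variation \<gamma> a b ?B y w s t \<in> Jac \<Omega>" if "t \<in> T" for s t
  proof -
    have "\<gamma> t \<in> Jac \<Omega>" using \<gamma> that by (simp add: smooth_curve_in_def)
    then show ?thesis
      unfolding affine_variation_def jac_mult_affine[symmetric]
      by (intro Jac_mult) (simp_all add: Jac_def transvection_in_Sp)
  qed
  ultimately show ?thesis
    by (auto simp: proper_variation_def affine_variation_def)
qed

lemma vector_derivative_affine_variation:
  "vector_derivative (\<lambda>s. affine_variation \<gamma> a b B y w s t) (at 0) =
    ((t - a) * (b - t)) *\<^sub>R affine_velocity B y w (\<gamma> t)"
  unfolding affine_variation_def
  by (rule vector_derivative_at) (auto intro!: derivative_eq_intros)

text \<open>The \<open>obtains\<close> form hands over the derivative \<xi>' together with the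
  equivalence, because the pointwise matrix equation needs both \<xi> and \<xi>' in the Lie
  algebra.\<close>

lemma geodesic_iff_euler_poincare:
  assumes T: "open T" "is_interval T" and \<gamma>: "smooth_curve_in (Jac \<Omega>) T \<gamma>"
  obtains \<xi>' where
    "\<And>t. t \<in> T \<Longrightarrow> ((\<lambda>t. mc (\<gamma> t) (vector_derivative \<gamma> (at t))) has_vector_derivative \<xi>' t) (at t)"
    and "\<And>t. t \<in> T \<Longrightarrow> \<xi>' t \<in> jac_algebra \<Omega>"
    and "\<And>t. t \<in> T \<Longrightarrow> mc (\<gamma> t) (vector_derivative \<gamma> (at t)) \<in> jac_algebra \<Omega>"
    and "geodesic (Jac \<Omega>) (left_invariant_metric \<Omega> (kinetic Nb)) T \<gamma> \<longleftrightarrow>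
      (\<forall>t\<in>T. \<forall>\<eta>\<in>jac_algebra \<Omega>. euler_poincare (mc (\<gamma> t) (vector_derivative \<gamma> (at t))) (\<xi>' t) \<eta> = 0)"
proof -
  have sm: "smooth_on \<gamma> T" and J: "\<And>t. t \<in> T \<Longrightarrow> \<gamma> t \<in> Jac \<Omega>"
    using \<gamma> by (auto simp: smooth_curve_in_def)
  define \<xi> where "\<xi> = (\<lambda>t. mc (\<gamma> t) (vector_derivative \<gamma> (at t)))"
  define \<xi>' where "\<xi>' = (\<lambda>t. frechet_derivative \<xi> (at t) 1)"
  note d\<gamma> = smooth_on_has_vector_derivative[OF sm]
  have "smooth_on (\<lambda>t. mc (\<gamma> t) (frechet_derivative \<gamma> (at t) 1)) T"
    by (intro smooth_on_mc T sm smooth_on_frechet)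
  then have sm\<xi>: "smooth_on \<xi> T"
    by (rule smooth_on_cong[OF T(1), rotated]) (simp add: \<xi>_def vector_derivative_at[OF d\<gamma>])
  have d\<xi>: "(\<xi> has_vector_derivative \<xi>' t) (at t)" if "t \<in> T" for t
    unfolding \<xi>'_def by (rule smooth_on_has_vector_derivative[OF sm\<xi> that])
  have \<xi>alg: "\<xi> t \<in> jac_algebra \<Omega>" if "t \<in> T" for t
    unfolding \<xi>_def vector_derivative_at[OF d\<gamma>[OF that]]
    by (rule mc_in_jac_algebra[OF J[OF that] tangent_vector_derivative[OF T(1) that J d\<gamma>[OF that]]])
  have \<xi>'alg: "\<xi>' t \<in> jac_algebra \<Omega>" if "t \<in> T" for t
  proof -
    \<comment> \<open>The Lie algebra is the kernel of a linear map, so the derivative of a curve in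
      it stays in it.\<close>
    let ?L = "\<lambda>p :: 'm jac. transpose (P ** fst p) - P ** fst p"
    have "linear ?L"
      by (rule linearI) (simp_all add: mm.add_right mm.scaleR_right transpose_add transpose_scaleR scaleR_diff_right)
    then have "((\<lambda>t. ?L (\<xi> t)) has_vector_derivative ?L (\<xi>' t)) (at t)"
      using bounded_linear.has_vector_derivative[OF _ d\<xi>[OF that]] linear_conv_bounded_linear by blast
    moreover have "((\<lambda>t. ?L (\<xi> t)) has_vector_derivative 0) (at t)"
    proof (rule has_vector_derivative_transform_within_open[where f = "\<lambda>t. 0"])
      show "0 = ?L (\<xi> t)" if "t \<in> T" for t
        using \<xi>alg[OF that] by (cases "\<xi> t") (simp add: jac_algebra_def sp_algebra_iff)
    qed (use T(1) that in auto)
    ultimately have "?L (\<xi>' t) = 0" by (rule vector_derivative_unique_at)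
    then show ?thesis by (cases "\<xi>' t") (simp add: jac_algebra_def sp_algebra_iff)
  qed
  let ?G = "left_invariant_metric \<Omega> (kinetic Nb)"
  have \<xi>_eq: "mc (\<gamma> t) (vector_derivative \<gamma> (at t)) = \<xi> t" for t
    by (simp add: \<xi>_def)
  note ed = energy_has_derivative[OF T \<gamma> _ _ _ _ d\<xi>[unfolded \<xi>_def], unfolded \<xi>_eq]
  have "geodesic (Jac \<Omega>) ?G T \<gamma> \<longleftrightarrow> (\<forall>t\<in>T. \<forall>\<eta>\<in>jac_algebra \<Omega>. euler_poincare (\<xi> t) (\<xi>' t) \<eta> = 0)"
    (is "?geo \<longleftrightarrow> ?ep")
  proof
    assume ep: ?ep
    show ?geo
      unfolding geodesic_def
    proof (intro conjI allI impI \<gamma>)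
      fix a b \<epsilon> \<Gamma>
      assume "a < b \<and> {a..b} \<subseteq> T \<and> \<epsilon> > 0 \<and> proper_variation (Jac \<Omega>) T \<gamma> a b \<epsilon> \<Gamma>"
      then have v: "proper_variation (Jac \<Omega>) T \<gamma> a b \<epsilon> \<Gamma>" "\<epsilon> > 0" "a < b" "{a..b} \<subseteq> T" by auto
      have "integral {a..b} (\<lambda>t. euler_poincare (\<xi> t) (\<xi>' t)
          (mc (\<gamma> t) (vector_derivative (\<lambda>s. \<Gamma> s t) (at 0)))) = integral {a..b} (\<lambda>t. 0)"
        using ep ed(2)[OF v] v(4) by (intro integral_cong) auto
      then show "((\<lambda>s. energy ?G a b (\<Gamma> s)) has_real_derivative 0) (at 0)"
        using ed(1)[OF v] by simp
    qed
  next
    assume geo: ?geo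
    show ?ep
    proof
      fix t0 assume t0: "t0 \<in> T"
      have "euler_poincare (\<xi> t0) (\<xi>' t0) (transvection_generator v, y, w) = 0" for v y w
      proof (rule fundamental_lemma_quadratic_weight[OF T(1) _ t0])
        let ?B = "transvection_generator v"
        have qc: "continuous_on T (\<lambda>t. polar (kinetic Nb) (f t) (g t))"
          if "continuous_on T f" "continuous_on T g" for f g
          by (rule bounded_bilinear.continuous_on[OF bounded_bilinear_polar_kinetic that])
        have "linear (\<lambda>\<xi>. jac_bracket \<xi> (?B, y, w))"
        proof (rule linearI)
          show "jac_bracket (p + q) (?B, y, w) = jac_bracket p (?B, y, w) + jac_bracket q (?B, y, w)" for p q
            by (cases p; cases q) (simp add: mm.add_left mm.add_right mv.add_left mv.add_right \<Omega>_bilinear)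
          show "jac_bracket (r *\<^sub>R p) (?B, y, w) = r *\<^sub>R jac_bracket p (?B, y, w)" for r p
            by (cases p) (simp add: mm.scaleR_left mm.scaleR_right mv.scaleR_left mv.scaleR_right
                \<Omega>_bilinear scaleR_diff_right)
        qed
        then have "bounded_linear (\<lambda>\<xi>. jac_bracket \<xi> (?B, y, w))"
          by (simp add: linear_conv_bounded_linear)
        note br = smooth_on_bounded_linear[OF this T(1) sm\<xi>]
        show "continuous_on T (\<lambda>t. euler_poincare (\<xi> t) (\<xi>' t) (?B, y, w))"
          unfolding euler_poincare_def \<xi>'_def
          by (intro continuous_intros qc smooth_on_continuous_on br smooth_on_frechet sm\<xi>)
        fix a b :: real
        assume ab: "a < b" "{a..b} \<subseteq> T"
        let ?\<Gamma> = "affine_variation \<gamma> a b ?B y w"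
        \<comment> \<open>The parameter range 1 is arbitrary: these variations stay in the group for
          every s.\<close>
        have v: "proper_variation (Jac \<Omega>) T \<gamma> a b 1 ?\<Gamma>"
          by (rule proper_affine_variation[OF T(1) \<gamma>])
        have "((\<lambda>s. energy ?G a b (?\<Gamma> s)) has_real_derivative 0) (at 0)"
          using geo v ab unfolding geodesic_def by (metis zero_less_one)
        from DERIV_unique[OF ed(1)[OF v zero_less_one ab] this]
        have int0: "integral {a..b} (\<lambda>t. euler_poincare (\<xi> t) (\<xi>' t)
            (mc (\<gamma> t) (vector_derivative (\<lambda>s. ?\<Gamma> s t) (at 0)))) = 0"
          by simp
        \<comment> \<open>The integrand is linear in \<eta>, so the weight factors out and the
          fundamental lemma applies.\<close>
        have eq: "euler_poincare (\<xi> t) (\<xi>' t) (mc (\<gamma> t) (vector_derivative (\<lambda>s. ?\<Gamma> s t) (at 0))) =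
            (t - a) * (b - t) * euler_poincare (\<xi> t) (\<xi>' t) (?B, y, w)" if "t \<in> {a..b}" for t
        proof -
          have "t \<in> T" using that ab by auto
          then have "mc (\<gamma> t) (vector_derivative (\<lambda>s. ?\<Gamma> s t) (at 0)) = ((t - a) * (b - t)) *\<^sub>R (?B, y, w)"
            unfolding vector_derivative_affine_variation
              linear_scale[OF bounded_linear.linear[OF bounded_linear_mc]]
            by (simp add: mc_affine_velocity[OF J])
          moreover have "euler_poincare (\<xi> t) (\<xi>' t) (r *\<^sub>R (?B, y, w)) =
              r * euler_poincare (\<xi> t) (\<xi>' t) (?B, y, w)" for r
          proof -
            have "jac_bracket (\<xi> t) (r *\<^sub>R (?B, y, w)) = r *\<^sub>R jac_bracket (\<xi> t) (?B, y, w)"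
              by (cases "\<xi> t") (simp add: mm.scaleR_left mm.scaleR_right mv.scaleR_left mv.scaleR_right
                \<Omega>_bilinear scaleR_diff_right)
            then show ?thesis
              unfolding euler_poincare_def
              by (simp only: bounded_bilinear.scaleR_right[OF bounded_bilinear_polar_kinetic])
                (simp add: algebra_simps)
          qed
          ultimately show ?thesis by simp
        qed
        show "integral {a..b} (\<lambda>t. (t - a) * (b - t) * euler_poincare (\<xi> t) (\<xi>' t) (?B, y, w)) = 0"
          by (rule trans[OF _ int0], rule integral_cong, rule eq[symmetric])
      qed
      then show "\<forall>\<eta>\<in>jac_algebra \<Omega>. euler_poincare (\<xi> t0) (\<xi>' t0) \<eta> = 0"
        by (rule euler_poincare_iff(2)[OF \<xi>alg[OF t0] \<xi>'alg[OF t0]])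
    qed
  qed
  with d\<xi> \<xi>'alg \<xi>alg show ?thesis unfolding \<xi>_def by (rule that)
qed

end

section \<open>Transfer to the original orthonormal basis\<close>

lemma orthogonal_conjugate_mult:
  fixes Q :: "real^'n^'n"
  assumes "orthogonal_matrix Q"
  shows "Q ** A ** transpose Q ** (Q ** B ** transpose Q) = Q ** (A ** B) ** transpose Q"
proof -
  have "Q ** A ** transpose Q ** (Q ** B ** transpose Q) = Q ** A ** (transpose Q ** Q) ** B ** transpose Q"
    by (simp only: matrix_mul_assoc)
  also have "\<dots> = Q ** A ** B ** transpose Q"
    using assms by (simp only: orthogonal_matrix_def matrix_mul_rid)
  finally show ?thesis by (simp add: matrix_mul_assoc)
qed

lemma commutator_conjugate:
  fixes Q :: "real^'n^'n"
  assumes "orthogonal_matrix Q"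
  shows "commutator (Q ** A ** transpose Q) (Q ** B ** transpose Q) = Q ** commutator A B ** transpose Q"
  by (simp only: commutator_def orthogonal_conjugate_mult[OF assms] mm.diff_left mm.diff_right)

theorem theorem2p3:
  fixes N :: "real^('m::finite option)^('m option)" and k :: nat
  assumes "CARD('m) = 2 * k"
    and "transpose N = - N"
    and "rank N + 1 = CARD('m option)"
  shows "(\<exists>Q Nb. corank1_normal_form N Q Nb) \<and>
    (\<forall>Q Nb T \<gamma>. corank1_normal_form N Q Nb \<longrightarrow>
       (let \<Omega> = matrix_form (- matrix_inv Nb);
            \<xi> = left_log_deriv \<Omega> \<gamma>;
            X = (\<lambda>t. Q ** jac_to_sym Nb (\<xi> t) ** transpose Q)
        in open T \<longrightarrow> is_interval T \<longrightarrow> smooth_curve_in (Jac \<Omega>) T \<gamma> \<longrightarrow>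
           (\<forall>t\<in>T. \<xi> t \<in> jac_algebra \<Omega> \<and> transpose (X t) = X t) \<and>
           (geodesic (Jac \<Omega>) (left_invariant_metric \<Omega> (kinetic Nb)) T \<gamma> \<longleftrightarrow>
            (\<forall>t\<in>T. (X has_vector_derivative commutator (X t ** X t) N) (at t)))))"
  unfolding Let_def
proof (intro conjI allI impI)
  show "\<exists>Q Nb. corank1_normal_form N Q Nb"
    by (rule skew_corank1_normal_form_exists[OF assms(2,3)])
next
  fix Q :: "real^('m option)^('m option)" and Nb :: "real^'m^'m"
    and T :: "real set" and \<gamma> :: "real \<Rightarrow> 'm jac"
  assume nf: "corank1_normal_form N Q Nb" and T: "open T" "is_interval T"
    and \<gamma>: "smooth_curve_in (Jac (matrix_form (- matrix_inv Nb))) T \<gamma>"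
  interpret symplectic_matrix Nb
    using nf by unfold_locales (auto simp: corank1_normal_form_def)
  have Q: "orthogonal_matrix Q" and NQ: "transpose Q ** N ** Q = block_matrix Nb 0 0 0"
    using nf by (auto simp: corank1_normal_form_def)
  let ?N0 = "block_matrix Nb 0 0 0 :: real^('m option)^('m option)"
  have QQ: "transpose Q ** Q = mat 1" "Q ** transpose Q = mat 1"
    using Q by (auto simp: orthogonal_matrix_def)
  have N: "N = Q ** ?N0 ** transpose Q"
  proof -
    have "Q ** ?N0 ** transpose Q = (Q ** transpose Q) ** N ** (Q ** transpose Q)"
      unfolding NQ[symmetric] by (simp only: matrix_mul_assoc)
    then show ?thesis by (simp add: QQ)
  qed
  have Qinj: "A = B" if "Q ** A ** transpose Q = Q ** B ** transpose Q" for A B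
  proof -
    have "transpose Q ** (Q ** A ** transpose Q) ** Q = A" for A
    proof -
      have "transpose Q ** (Q ** A ** transpose Q) ** Q = (transpose Q ** Q) ** A ** (transpose Q ** Q)"
        by (simp only: matrix_mul_assoc)
      then show ?thesis by (simp add: QQ)
    qed
    with that show ?thesis by metis
  qed
  define \<xi> where "\<xi> = (\<lambda>t. mc (\<gamma> t) (vector_derivative \<gamma> (at t)))"
  obtain \<xi>' where d\<xi>: "\<And>t. t \<in> T \<Longrightarrow> (\<xi> has_vector_derivative \<xi>' t) (at t)"
    and \<xi>': "\<And>t. t \<in> T \<Longrightarrow> \<xi>' t \<in> jac_algebra \<Omega>"
    and \<xi>: "\<And>t. t \<in> T \<Longrightarrow> \<xi> t \<in> jac_algebra \<Omega>"
    and geo: "geodesic (Jac \<Omega>) (left_invariant_metric \<Omega> (kinetic Nb)) T \<gamma> \<longleftrightarrow>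
      (\<forall>t\<in>T. \<forall>\<eta>\<in>jac_algebra \<Omega>. euler_poincare (\<xi> t) (\<xi>' t) \<eta> = 0)"
    by (rule geodesic_iff_euler_poincare[OF T \<gamma>]) (rule that, simp_all only: \<xi>_def)
  \<comment> \<open>The identification relies on the curve lying in the group, which is known on T;
    derivatives are later transferred using that T is open.\<close>
  have log: "left_log_deriv \<Omega> \<gamma> t = \<xi> t" if "t \<in> T" for t
    using \<gamma> that by (simp add: left_log_deriv_def \<xi>_def to_identity_eq smooth_curve_in_def)
  let ?X = "\<lambda>t. Q ** jac_to_sym Nb (left_log_deriv \<Omega> \<gamma> t) ** transpose Q"
  have X: "?X t = Q ** jac_to_sym Nb (\<xi> t) ** transpose Q" if "t \<in> T" for t
    by (simp add: log[OF that])
  show "\<forall>t\<in>T. left_log_deriv \<Omega> \<gamma> t \<in> jac_algebra \<Omega> \<and> transpose (?X t) = ?X t"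
  proof
    fix t assume t: "t \<in> T"
    have "transpose (jac_to_sym Nb (\<xi> t)) = jac_to_sym Nb (\<xi> t)"
      using \<xi>[OF t] by (cases "\<xi> t") (simp add: transpose_block_matrix jac_algebra_def sp_algebra_iff)
    then show "left_log_deriv \<Omega> \<gamma> t \<in> jac_algebra \<Omega> \<and> transpose (?X t) = ?X t"
      using \<xi>[OF t] by (simp add: log[OF t] matrix_transpose_mul matrix_mul_assoc)
  qed
  \<comment> \<open>Since \<open>jac_to_sym Nb\<close> and conjugation by Q are linear, X has the
    image of \<xi>' as its derivative in any case. The differential equation at t is thus an
    algebraic identity, from which \<open>Qinj\<close> strips Q.\<close>
  have "(?X has_vector_derivative commutator (?X t ** ?X t) N) (at t) \<longleftrightarrow>
      (\<forall>\<eta>\<in>jac_algebra \<Omega>. euler_poincare (\<xi> t) (\<xi>' t) \<eta> = 0)" if t: "t \<in> T" for t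
  proof -
    let ?Y = "jac_to_sym Nb (\<xi> t)"
    have "((\<lambda>t. Q ** jac_to_sym Nb (\<xi> t) ** transpose Q) has_vector_derivative
        Q ** jac_to_sym Nb (\<xi>' t) ** transpose Q) (at t)"
      by (intro bounded_linear.has_vector_derivative[OF mm.bounded_linear_left]
          bounded_linear.has_vector_derivative[OF mm.bounded_linear_right]
          bounded_linear.has_vector_derivative[OF bounded_linear_jac_to_sym] d\<xi> t)
    then have dX: "(?X has_vector_derivative Q ** jac_to_sym Nb (\<xi>' t) ** transpose Q) (at t)"
      by (rule has_vector_derivative_transform_within_open[OF _ T(1) t]) (simp add: log)
    have "?X t ** ?X t = Q ** (?Y ** ?Y) ** transpose Q"
      unfolding X[OF t] by (rule orthogonal_conjugate_mult[OF Q])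
    then have "commutator (?X t ** ?X t) N = Q ** commutator (?Y ** ?Y) ?N0 ** transpose Q"
      by (simp only: N commutator_conjugate[OF Q])
    then have "(?X has_vector_derivative commutator (?X t ** ?X t) N) (at t) \<longleftrightarrow>
        jac_to_sym Nb (\<xi>' t) = commutator (?Y ** ?Y) ?N0"
      using dX Qinj vector_derivative_unique_at[OF dX] by metis
    then show ?thesis
      by (simp only: euler_poincare_iff(1)[OF \<xi>[OF t] \<xi>'[OF t]])
  qed
  then show "geodesic (Jac \<Omega>) (left_invariant_metric \<Omega> (kinetic Nb)) T \<gamma> \<longleftrightarrow>
      (\<forall>t\<in>T. (?X has_vector_derivative commutator (?X t ** ?X t) N) (at t))"
    unfolding geo by blast
qed

end
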